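(* Let $X$ be a separable symmetric space on $[0,1]$ and let $f\in X$ satisfy $f=f^*$. Suppose the system $\{V^\alpha f\}_{\alpha\in\mathbb{A}}$ is an absolutely representing system in $X$ with constant $C$, i.e. for every $x\in X$ there exist real coefficients $\{\xi_\alpha\}_{\alpha\in\mathbb{A}}$ with $x=\sum_{k=0}^\infty\sum_{|\alpha|=k}\xi_\alpha V^\alpha f$ in $X$ and $\sum_{k=0}^\infty\bigl\|\sum_{|\alpha|=k}\xi_\alpha V^\alpha f\bigr\|_X\le C\|x\|_X$. Then $$\|\sigma_tf\|_X\le 2C\Bigl|\int_0^1f(s)\,ds\Bigr|\,\phi_X(t),\qquad 0<t\le1.$$
   Context: A symmetric space $X$ on $[0,1]$ is a Banach space of (equivalence classes of) real-valued Lebesgue measurable functions on $[0,1]$ such that: (a) if $y\in X$ and $x$ is measurable with $|x|\le|y|$ a.e., then $x\in X$ and $\|x\|_X\le\|y\|_X$; (b) if $x,y$ are equimeasurable and $y\in X$, then $x\in X$ and $\|x\|_X=\|y\|_X$; normalized so that $\|\chi_{[0,1]}\|_X=1$. $x^*$ denotes the decreasing right-continuous rearrangement of $|x|$, $x^*(t)=\inf\{s\ge0: m\{|x|>s\}\le t\}$; so $f=f^*$ means $f$ is nonnegative, nonincreasing and right-continuous. The fundamental function is $\phi_X(t)=\|\chi_{[0,t]}\|_X$. The dilation operator is $\sigma_\tau x(t)=x(t/\tau)\chi_{(0,\min(1,\tau))}(t)$. For $f\in L_1[0,1]$: $V_0f(t)=f(2t)$ on $[0,\frac12]$, $0$ on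 $(\frac12,1]$; $V_1f(t)=0$ on $[0,\frac12)$, $f(2t-1)$ on $[\frac12,1]$. $\mathbb{A}=\bigcup_{k\ge0}\{0,1\}^k$; for $\alpha=(\alpha_1,\dots,\alpha_k)$, $|\alpha|=k$, $V^\alpha f=V_{\alpha_1}\cdots V_{\alpha_k}f$ (identity for $k=0$), i.e. $V^\alpha f(t)=f(2^kt-i)$ on $[i2^{-k},(i+1)2^{-k}]$, $0$ elsewhere, $i=\sum\alpha_\nu2^{k-\nu}$. *)

theory Defs
  imports "HOL-Analysis.Analysis"
begin

text \<open>Functions on [0,1] are represented as real => real; only values on [0,1]
  matter (all conditions are up to a.e. equality w.r.t. Lebesgue measure on [0,1]).\<close>

definition M01 :: "real measure" where
  "M01 = lebesgue_on {0..1}"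

definition equimeasurable :: "(real \<Rightarrow> real) \<Rightarrow> (real \<Rightarrow> real) \<Rightarrow> bool" where
  "equimeasurable x y \<longleftrightarrow>
     (\<forall>s. measure M01 {t \<in> space M01. x t > s} = measure M01 {t \<in> space M01. y t > s})"

definition symmetric_space :: "(real \<Rightarrow> real) set \<Rightarrow> ((real \<Rightarrow> real) \<Rightarrow> real) \<Rightarrow> bool" where
  "symmetric_space X N \<longleftrightarrow>
     X \<subseteq> borel_measurable M01 \<and>
     (\<forall>x\<in>X. \<forall>y\<in>X. (\<lambda>t. x t + y t) \<in> X) \<and>
     (\<forall>x\<in>X. \<forall>c::real. (\<lambda>t. c * x t) \<in> X) \<and>
     (\<forall>x\<in>X. N x \<ge> 0) \<and>
     (\<forall>x\<in>X. N x = 0 \<longleftrightarrow> (AE t in M01. x t = 0)) \<and>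
     (\<forall>x\<in>X. \<forall>y\<in>X. N (\<lambda>t. x t + y t) \<le> N x + N y) \<and>
     (\<forall>x\<in>X. \<forall>c::real. N (\<lambda>t. c * x t) = \<bar>c\<bar> * N x) \<and>
     (\<forall>u::nat \<Rightarrow> real \<Rightarrow> real. (\<forall>n. u n \<in> X) \<and>
        (\<forall>e>0. \<exists>K. \<forall>m\<ge>K. \<forall>n\<ge>K. N (\<lambda>t. u m t - u n t) < e)
        \<longrightarrow> (\<exists>x\<in>X. (\<lambda>n. N (\<lambda>t. u n t - x t)) \<longlonglongrightarrow> 0)) \<and>
     (\<forall>x y. y \<in> X \<and> x \<in> borel_measurable M01 \<and> (AE t in M01. \<bar>x t\<bar> \<le> \<bar>y t\<bar>)
        \<longrightarrow> x \<in> X \<and> N x \<le> N y) \<and>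
     (\<forall>x y. y \<in> X \<and> x \<in> borel_measurable M01 \<and> equimeasurable x y
        \<longrightarrow> x \<in> X \<and> N x = N y) \<and>
     N (indicator {0..1}) = 1"

definition separable_symm :: "(real \<Rightarrow> real) set \<Rightarrow> ((real \<Rightarrow> real) \<Rightarrow> real) \<Rightarrow> bool" where
  "separable_symm X N \<longleftrightarrow>
     (\<exists>D. countable D \<and> D \<subseteq> X \<and> (\<forall>x\<in>X. \<forall>e>0. \<exists>d\<in>D. N (\<lambda>t. x t - d t) < e))"

definition drearr :: "(real \<Rightarrow> real) \<Rightarrow> real \<Rightarrow> real" where
  "drearr x t = Inf {s. s \<ge> 0 \<and> measure M01 {u \<in> space M01. \<bar>x u\<bar> > s} \<le> t}"

definition fundamental :: "((real \<Rightarrow> real) \<Rightarrow> real) \<Rightarrow> real \<Rightarrow> real" where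
  "fundamental N t = N (indicator {0..t})"

definition dil :: "real \<Rightarrow> (real \<Rightarrow> real) \<Rightarrow> real \<Rightarrow> real" where
  "dil \<tau> x t = (if 0 < t \<and> t < min 1 \<tau> then x (t / \<tau>) else 0)"

definition V0 :: "(real \<Rightarrow> real) \<Rightarrow> real \<Rightarrow> real" where
  "V0 f t = (if 0 \<le> t \<and> t \<le> 1/2 then f (2 * t) else 0)"

definition V1 :: "(real \<Rightarrow> real) \<Rightarrow> real \<Rightarrow> real" where
  "V1 f t = (if 1/2 \<le> t \<and> t \<le> 1 then f (2 * t - 1) else 0)"

fun Valpha :: "bool list \<Rightarrow> (real \<Rightarrow> real) \<Rightarrow> real \<Rightarrow> real" where
  "Valpha [] f = f"
| "Valpha (a # as) f = (if a then V1 else V0) (Valpha as f)"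

definition level_sum :: "(bool list \<Rightarrow> real) \<Rightarrow> (real \<Rightarrow> real) \<Rightarrow> nat \<Rightarrow> real \<Rightarrow> real" where
  "level_sum \<xi> f k t = (\<Sum>\<alpha>\<in>{\<alpha>::bool list. length \<alpha> = k}. \<xi> \<alpha> * Valpha \<alpha> f t)"

definition abs_representing :: "(real \<Rightarrow> real) set \<Rightarrow> ((real \<Rightarrow> real) \<Rightarrow> real) \<Rightarrow> (real \<Rightarrow> real) \<Rightarrow> real \<Rightarrow> bool" where
  "abs_representing X N f C \<longleftrightarrow>
     (\<forall>x\<in>X. \<exists>\<xi>::bool list \<Rightarrow> real.
        (\<forall>k. level_sum \<xi> f k \<in> X) \<and>
        (\<lambda>n. N (\<lambda>t. x t - (\<Sum>k<n. level_sum \<xi> f k t))) \<longlonglongrightarrow> 0 \<and>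
        summable (\<lambda>k. N (level_sum \<xi> f k)) \<and>
        (\<Sum>k. N (level_sum \<xi> f k)) \<le> C * N x)"

end

theory Submission
  imports Defs "HOL-Probability.Distribution_Functions"
begin

text \<open>
  Let $t = 2^{-n}$ and $E = [1 - t, 1]$, represent $\chi_E = \sum_k L_k$, where $L_k$ is the
  $k$-th level sum, and integrate over $E$. It suffices that
  $\|\sigma_t f\| \, |\int_E L_k| \le t \int f \, \|L_k\|$ for every $k$.
  If $k < n$, then $E$ lies in the last dyadic interval of length $2^{-k}$, where $L_k$ is a
  multiple of a dilated copy of $f$; the mean of a decreasing function over a right end segment
  is at most its total mean. (This is why $E$ sits at the right end of the unit interval.)
  If $k \ge n$, replacing the coefficients of the dyadic intervals inside $E$ by the average
  of their absolute values does not increase the norm, because this average is a mean of cyclic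
  permutations, each giving an equimeasurable function; the averaged function is equimeasurable
  with a multiple of $\sigma_t f$. The same averaging, applied to the decreasing rearrangement,
  shows that the $X$-norm dominates the $L_1$-norm, so the series may be integrated termwise.
  The factor 2 comes from passing to an arbitrary $t$ through
  $\phi_X(2t) \le 2 \phi_X(t)$.
\<close>

subsection \<open>The measure space [0,1]\<close>

lemma space_M01: "space M01 = {0..1}"
  by (simp add: M01_def)

lemma prob_space_M01: "prob_space M01"
  unfolding M01_def by (rule prob_spaceI) (simp add: emeasure_restrict_space)

interpretation M01: prob_space M01
  by (rule prob_space_M01)

lemma borel_measurable_M01I [measurable_dest]:
  "h \<in> borel_measurable borel \<Longrightarrow> h \<in> borel_measurable M01"
  unfolding M01_def
  by (intro measurable_restrict_space1) (simp add: measurable_completion)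

lemma AE_M01I:
  assumes "countable Z" and "\<And>t. 0 < t \<Longrightarrow> t < 1 \<Longrightarrow> t \<notin> Z \<Longrightarrow> P t"
  shows "AE t in M01. P t"
proof -
  have "AE t in lborel. t \<notin> Z \<union> {0,1}"
    using assms(1) by (intro AE_not_in countable_imp_null_set_lborel) auto
  then have "AE t in lebesgue. t \<notin> Z \<union> {0,1}"
    by (rule AE_completion)
  then have "AE t in lebesgue. t \<in> {0..1} \<longrightarrow> P t"
    by eventually_elim (use assms(2) in force)
  then show ?thesis
    unfolding M01_def by (subst AE_restrict_space_iff) auto
qed

text \<open>Passing from [0,1] to [0,1) costs only a null set. The half-open form is wanted because
  K compressed copies of [0,1) tile it without overlap, which \<open>integral_glue\<close> relies
  on.\<close>

lemma
  fixes h :: "real \<Rightarrow> real"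
  assumes h [measurable]: "h \<in> borel_measurable borel"
  shows integral_M01_borel:
      "integral\<^sup>L M01 h = (LINT u|lborel. indicator {0..<1} u * h u)"
    and integrable_M01_borel:
      "integrable M01 h \<longleftrightarrow> integrable lborel (\<lambda>u. indicator {0..<1} u * h u)"
proof -
  have ae: "AE u in lborel. indicator {0..1} u * h u = indicator {0..<1} u * h u"
    using AE_lborel_singleton[of "1::real"] by eventually_elim (auto simp: indicator_def)
  have "integral\<^sup>L M01 h = (LINT u|lebesgue. indicator {0..1} u * h u)"
    unfolding M01_def by (subst integral_restrict_space) auto
  also have "\<dots> = (LINT u|lborel. indicator {0..1} u * h u)"
    by (rule integral_completion) simp
  also have "\<dots> = (LINT u|lborel. indicator {0..<1} u * h u)"
    by (rule integral_cong_AE) (use ae in auto)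
  finally show "integral\<^sup>L M01 h = (LINT u|lborel. indicator {0..<1} u * h u)" .
  have "integrable M01 h \<longleftrightarrow> integrable lebesgue (\<lambda>u. indicator {0..1} u * h u)"
    unfolding M01_def by (subst integrable_restrict_space) auto
  also have "\<dots> \<longleftrightarrow> integrable lborel (\<lambda>u. indicator {0..1} u * h u)"
    by (rule integrable_completion) simp
  also have "\<dots> \<longleftrightarrow> integrable lborel (\<lambda>u. indicator {0..<1} u * h u)"
    by (rule integrable_cong_AE) (use ae in auto)
  finally show "integrable M01 h \<longleftrightarrow> integrable lborel (\<lambda>u. indicator {0..<1} u * h u)" .
qed

subsection \<open>Piecewise dilated functions\<close>

text \<open>Copies of \<open>h 0, \<dots>, h (K - 1)\<close>, each compressed by the factor \<open>K\<close>, placed side by side on [0,1).\<close>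

definition glue :: "nat \<Rightarrow> (nat \<Rightarrow> real \<Rightarrow> real) \<Rightarrow> real \<Rightarrow> real" where
  "glue K h t = (\<Sum>i<K. indicator {0..<1} (real K * t - real i) * h i (real K * t - real i))"

lemma glue_measurable [measurable]:
  assumes "\<And>i. i < K \<Longrightarrow> h i \<in> borel_measurable borel"
  shows "glue K h \<in> borel_measurable borel"
proof -
  have "(\<lambda>t. indicator {0..<1} (real K * t - real i) * h i (real K * t - real i)) \<in> borel_measurable borel"
    if "i < K" for i
    using assms[OF that, measurable] by measurable
  then show ?thesis
    unfolding glue_def[abs_def] by (intro borel_measurable_sum) auto
qed

lemma glue_eq:
  assumes "i < K" "0 \<le> real K * t - real i" "real K * t - real i < 1"
  shows "glue K h t = h i (real K * t - real i)"
proof -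
  have "indicator {0..<1} (real K * t - real j) = (if j = i then 1 else 0::real)" if "j < K" for j
    using assms by (auto simp: indicator_def)
  then have "glue K h t = (\<Sum>j<K. if j = i then h i (real K * t - real i) else 0)"
    unfolding glue_def by (intro sum.cong) auto
  also have "\<dots> = h i (real K * t - real i)"
    using assms by simp
  finally show ?thesis .
qed

lemma glue_index:
  assumes "0 \<le> t" "t < 1" "0 < K"
  obtains i where "i < K" "0 \<le> real K * t - real i" "real K * t - real i < 1"
proof -
  define i where "i = nat \<lfloor>real K * t\<rfloor>"
  have "real K * t < real K" and "0 \<le> real K * t"
    using assms by auto
  then have "real i \<le> real K * t" "real K * t < real i + 1"
    unfolding i_def by (simp_all add: of_nat_nat)
  with \<open>real K * t < real K\<close> show ?thesis
    by (intro that[of i]) auto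
qed

text \<open>The arbitrary relation \<open>R\<close> covers both equality of glued functions and
  comparison of their absolute values.\<close>

lemma glue_cong:
  assumes "0 \<le> t" "t < 1" "0 < K"
    and "\<And>i. i < K \<Longrightarrow> 0 \<le> real K * t - real i \<Longrightarrow> real K * t - real i < 1 \<Longrightarrow>
      R (h i (real K * t - real i)) (h' i (real K * t - real i))"
  shows "R (glue K h t) (glue K h' t)"
proof -
  obtain i where i: "i < K" "0 \<le> real K * t - real i" "real K * t - real i < 1"
    using glue_index[OF assms(1-3)] .
  show ?thesis
    using assms(4)[OF i] by (simp add: glue_eq[OF i])
qed

lemma
  assumes [measurable]: "\<And>i. i < K \<Longrightarrow> h i \<in> borel_measurable borel"
    and int: "\<And>i. i < K \<Longrightarrow> integrable M01 (h i)"
    and "0 < K"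
  shows integral_glue: "integral\<^sup>L M01 (glue K h) = (\<Sum>i<K. integral\<^sup>L M01 (h i)) / real K"
    and integrable_glue: "integrable M01 (glue K h)"
proof -
  let ?p = "\<lambda>i u. indicator {0..<1} u * h i u :: real"
  \<comment> \<open>This holds for every real t: off [0,1) each K t - i also falls outside [0,1).
    Hence the affine substitution on the whole line applies to each summand separately.\<close>
  have eq: "indicator {0..<1} t * glue K h t = (\<Sum>i<K. ?p i (- real i + real K * t))" for t
  proof (cases "t \<in> {0..<1}")
    case False
    have "?p i (- real i + real K * t) = 0" if "i < K" for i
    proof (cases "t < 0")
      case True
      then have "real K * t < 0" using \<open>0 < K\<close> by (simp add: mult_less_0_iff)
      then show ?thesis by simp
    next
      case f: False
      then have "real K * 1 \<le> real K * t"
        using False \<open>0 < K\<close> by (intro mult_left_mono) auto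
      moreover have "real i + 1 \<le> real K"
        using that by linarith
      ultimately have "1 \<le> - real i + real K * t" by linarith
      then show ?thesis by (simp add: indicator_def)
    qed
    then have "(\<Sum>i<K. ?p i (- real i + real K * t)) = 0"
      by (intro sum.neutral) auto
    then show ?thesis
      using False by (simp only: indicator_simps(2) not_False_eq_True mult_zero_left if_False)
  qed (simp add: glue_def)
  have I: "integrable lborel (?p i)" if "i < K" for i
    using int[OF that] by (subst (asm) integrable_M01_borel) (use that in auto)
  have I': "integrable lborel (\<lambda>t. ?p i (- real i + real K * t))" if "i < K" for i
    using lborel_integrable_real_affine[OF I[OF that], of "real K" "- real i"] \<open>0 < K\<close> by simp
  have J: "(LINT t|lborel. ?p i (- real i + real K * t)) = integral\<^sup>L M01 (h i) / real K" if "i < K" for i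
    using lborel_integral_real_affine[of "real K" "?p i" "- real i"] \<open>0 < K\<close> that
    by (simp add: integral_M01_borel)
  have gm: "glue K h \<in> borel_measurable borel"
    by measurable
  show "integrable M01 (glue K h)"
    unfolding integrable_M01_borel[OF gm] eq
    using I' by (intro Bochner_Integration.integrable_sum) auto
  have "integral\<^sup>L M01 (glue K h) = (LINT t|lborel. (\<Sum>i<K. ?p i (- real i + real K * t)))"
    by (simp only: integral_M01_borel[OF gm] eq)
  also have "\<dots> = (\<Sum>i<K. integral\<^sup>L M01 (h i) / real K)"
    by (subst Bochner_Integration.integral_sum) (use I' J in auto)
  finally show "integral\<^sup>L M01 (glue K h) = (\<Sum>i<K. integral\<^sup>L M01 (h i)) / real K"
    by (simp add: sum_divide_distrib)
qed

section \<open>Distribution functions of glued functions\<close>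

definition dist_fun :: "(real \<Rightarrow> real) \<Rightarrow> real \<Rightarrow> real" where
  "dist_fun x s = measure M01 {t \<in> space M01. x t > s}"

lemma dist_fun_integral:
  assumes [measurable]: "x \<in> borel_measurable M01"
  shows "dist_fun x s = (LINT t|M01. indicator {s<..} (x t))"
proof -
  have "(LINT t|M01. indicator {s<..} (x t) :: real) =
      (LINT t|M01. indicator {t \<in> space M01. x t > s} t)"
    by (intro Bochner_Integration.integral_cong) (auto simp: indicator_def)
  also have "\<dots> = dist_fun x s"
    unfolding dist_fun_def by (subst Bochner_Integration.integral_indicator) (auto intro!: arg_cong[where f = "measure M01"])
  finally show ?thesis ..
qed

lemma equimeasurable_dist_fun: "equimeasurable x y \<longleftrightarrow> (\<forall>s. dist_fun x s = dist_fun y s)"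
  by (simp add: equimeasurable_def dist_fun_def)

text \<open>Composition with the indicator of the half-line above s acts on each piece separately,
  so this is \<open>integral_glue\<close> for those indicators. In particular, permuting the pieces
  does not change the distribution.\<close>

lemma dist_fun_glue:
  assumes [measurable]: "\<And>i. i < K \<Longrightarrow> h i \<in> borel_measurable borel" and "0 < K"
  shows "dist_fun (glue K h) s = (\<Sum>i<K. dist_fun (h i) s) / real K"
proof -
  let ?h = "\<lambda>i u. indicator {s<..} (h i u) :: real"
  have m: "?h i \<in> borel_measurable borel" if "i < K" for i
    using that by measurable
  have m': "glue K h \<in> borel_measurable M01"
    by (intro borel_measurable_M01I) measurable
  have "dist_fun (glue K h) s = (LINT t|M01. indicator {s<..} (glue K h t))"
    using m' by (rule dist_fun_integral)
  also have "\<dots> = integral\<^sup>L M01 (glue K ?h)"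
  proof (rule integral_cong_AE)
    show "AE t in M01. indicator {s<..} (glue K h t) = glue K ?h t"
    proof (rule AE_M01I[of "{}"])
      fix t :: real assume t: "0 < t" "t < 1"
      then obtain i where i: "i < K" "0 \<le> real K * t - real i" "real K * t - real i < 1"
        using glue_index[of t K] \<open>0 < K\<close> by auto
      show "indicator {s<..} (glue K h t) = glue K ?h t"
        by (simp add: glue_eq[OF i])
    qed simp
  qed (use m m' in \<open>auto intro!: borel_measurable_M01I glue_measurable borel_measurable_indicator'\<close>)
  also have "\<dots> = (\<Sum>i<K. integral\<^sup>L M01 (?h i)) / real K"
    using m \<open>0 < K\<close>
    by (intro integral_glue M01.integrable_const_bound[of _ 1]) (auto intro: borel_measurable_M01I)
  also have "\<dots> = (\<Sum>i<K. dist_fun (h i) s) / real K"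
    using assms by (intro arg_cong2[where f = "(/)"] sum.cong refl dist_fun_integral[symmetric])
      (auto intro: borel_measurable_M01I)
  finally show ?thesis .
qed

subsection \<open>Level sums as piecewise dilated functions\<close>

lemma level_sum_Suc:
  "level_sum \<xi> f (Suc k) t =
     V0 (level_sum (\<lambda>a. \<xi> (False # a)) f k) t + V1 (level_sum (\<lambda>a. \<xi> (True # a)) f k) t"
proof -
  let ?A = "{\<alpha>::bool list. length \<alpha> = k}"
  have fin: "finite ?A"
    using finite_lists_length_eq[of "UNIV::bool set" k] by simp
  have "{\<alpha>::bool list. length \<alpha> = Suc k} = Cons False ` ?A \<union> Cons True ` ?A"
    by (auto simp: length_Suc_conv image_iff)
  then have "level_sum \<xi> f (Suc k) t =
     (\<Sum>\<alpha>\<in>?A. \<xi> (False # \<alpha>) * V0 (Valpha \<alpha> f) t) + (\<Sum>\<alpha>\<in>?A. \<xi> (True # \<alpha>) * V1 (Valpha \<alpha> f) t)"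
    unfolding level_sum_def
    by (simp only:) (subst sum.union_disjoint, use fin in \<open>auto simp: sum.reindex inj_on_def\<close>)
  then show ?thesis
    by (auto simp: V0_def V1_def level_sum_def sum_distrib_left)
qed

text \<open>Grid points are excluded because \<open>V0\<close> and \<open>V1\<close> live on closed
  intervals that share end points, whereas \<open>glue\<close> uses half-open ones.\<close>

lemma level_sum_glue:
  "\<exists>c. \<forall>t. 0 \<le> t \<longrightarrow> t < 1 \<longrightarrow> 2 ^ k * t \<notin> \<int> \<longrightarrow>
     level_sum \<xi> f k t = glue (2 ^ k) (\<lambda>i u. c i * f u) t"
proof (induction k arbitrary: \<xi>)
  case 0
  have "level_sum \<xi> f 0 t = \<xi> [] * f t" for t
    by (simp add: level_sum_def)
  then show ?case
    by (intro exI[of _ "\<lambda>_. \<xi> []"]) (auto simp: glue_def indicator_def)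
next
  case (Suc k)
  obtain c0 where c0: "\<And>t. 0 \<le> t \<Longrightarrow> t < 1 \<Longrightarrow> 2 ^ k * t \<notin> \<int> \<Longrightarrow>
     level_sum (\<lambda>a. \<xi> (False # a)) f k t = glue (2 ^ k) (\<lambda>i u. c0 i * f u) t"
    using Suc.IH by metis
  obtain c1 where c1: "\<And>t. 0 \<le> t \<Longrightarrow> t < 1 \<Longrightarrow> 2 ^ k * t \<notin> \<int> \<Longrightarrow>
     level_sum (\<lambda>a. \<xi> (True # a)) f k t = glue (2 ^ k) (\<lambda>i u. c1 i * f u) t"
    using Suc.IH by metis
  \<comment> \<open>The outermost operator selects the half of [0,1], so the coefficient sequences
    of the two halves are concatenated.\<close>
  define c where "c i = (if i < 2 ^ k then c0 i else c1 (i - 2 ^ k))" for i :: nat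
  have "level_sum \<xi> f (Suc k) t = glue (2 ^ Suc k) (\<lambda>i u. c i * f u) t"
    if t: "0 \<le> t" "t < 1" "2 ^ Suc k * t \<notin> \<int>" for t
  proof -
    have "t \<noteq> 1/2"
    proof
      assume "t = 1/2"
      then have "2 ^ Suc k * t = 2 ^ k" by simp
      with t(3) show False by (metis Ints_numeral Ints_power)
    qed
    then consider "t < 1/2" | "t > 1/2" by linarith
    then show ?thesis
    proof cases
      case 1
      obtain i where i: "i < 2 ^ k" "0 \<le> real (2 ^ k) * (2 * t) - real i" "real (2 ^ k) * (2 * t) - real i < 1"
        using glue_index[of "2 * t" "2 ^ k"] 1 t by auto
      have "level_sum \<xi> f (Suc k) t = glue (2 ^ k) (\<lambda>i u. c0 i * f u) (2 * t)"
        using 1 t c0[of "2 * t"] by (simp add: level_sum_Suc V0_def V1_def mult.assoc mult.left_commute)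
      also have "\<dots> = c i * f (real (2 ^ k) * (2 * t) - real i)"
        using i by (subst glue_eq[OF i]) (simp add: c_def)
      also have "\<dots> = glue (2 ^ Suc k) (\<lambda>i u. c i * f u) t"
        using i by (subst glue_eq[of i]) (auto simp: mult_ac)
      finally show ?thesis .
    next
      case 2
      have nz: "2 ^ k * (2 * t - 1) \<notin> \<int>"
      proof
        assume "2 ^ k * (2 * t - 1) \<in> \<int>"
        then have "2 ^ k * (2 * t - 1) + 2 ^ k \<in> \<int>"
          by (intro Ints_add Ints_power) auto
        with t(3) show False by (simp add: algebra_simps)
      qed
      obtain i where i: "i < 2 ^ k" "0 \<le> real (2 ^ k) * (2 * t - 1) - real i" "real (2 ^ k) * (2 * t - 1) - real i < 1"
        using glue_index[of "2 * t - 1" "2 ^ k"] 2 t by auto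
      have "level_sum \<xi> f (Suc k) t = glue (2 ^ k) (\<lambda>i u. c1 i * f u) (2 * t - 1)"
        using 2 t c1[of "2 * t - 1"] nz by (simp add: level_sum_Suc V0_def V1_def)
      also have "\<dots> = c (i + 2 ^ k) * f (real (2 ^ k) * (2 * t - 1) - real i)"
        using i by (subst glue_eq[OF i]) (simp add: c_def)
      also have "\<dots> = glue (2 ^ Suc k) (\<lambda>i u. c i * f u) t"
        using i by (subst glue_eq[of "i + 2 ^ k"]) (auto simp: algebra_simps)
      finally show ?thesis .
    qed
  qed
  then show ?case by blast
qed

text \<open>Off the grid all rescaled arguments lie strictly inside (0,1), so f may be replaced by
  any function that agrees with it there. This is used to pass to a Borel function.\<close>

lemma level_sum_glue_AE:
  assumes "\<And>u. 0 < u \<Longrightarrow> u < 1 \<Longrightarrow> f u = f' u"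
  obtains c where "AE t in M01. level_sum \<xi> f k t = glue (2 ^ k) (\<lambda>i u. c i * f' u) t"
proof -
  obtain c where c: "\<And>t. 0 \<le> t \<Longrightarrow> t < 1 \<Longrightarrow> 2 ^ k * t \<notin> \<int> \<Longrightarrow>
     level_sum \<xi> f k t = glue (2 ^ k) (\<lambda>i u. c i * f u) t"
    using level_sum_glue by metis
  have "countable ((\<lambda>t::real. t / 2 ^ k) ` \<int>)"
    by (intro countable_image) (simp add: Ints_def)
  then have "AE t in M01. level_sum \<xi> f k t = glue (2 ^ k) (\<lambda>i u. c i * f' u) t"
  proof (rule AE_M01I)
    fix t :: real assume t: "0 < t" "t < 1" "t \<notin> (\<lambda>t. t / 2 ^ k) ` \<int>"
    have nz: "2 ^ k * t \<notin> \<int>"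
    proof
      assume "2 ^ k * t \<in> \<int>"
      then have "(2 ^ k * t) / 2 ^ k \<in> (\<lambda>t. t / 2 ^ k) ` \<int>" by (rule imageI)
      with t(3) show False by simp
    qed
    then have "level_sum \<xi> f k t = glue (2 ^ k) (\<lambda>i u. c i * f u) t"
      using t by (intro c) auto
    also have "\<dots> = glue (2 ^ k) (\<lambda>i u. c i * f' u) t"
    proof (rule glue_cong)
      fix i :: nat
      assume i: "0 \<le> real (2 ^ k) * t - real i" "real (2 ^ k) * t - real i < 1"
      have "2 ^ k * t \<noteq> real i" using nz by auto
      then have "f (real (2 ^ k) * t - real i) = f' (real (2 ^ k) * t - real i)"
        using i by (intro assms) auto
      then show "c i * f (real (2 ^ k) * t - real i) = c i * f' (real (2 ^ k) * t - real i)"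
        by simp
    qed (use t in auto)
    finally show "level_sum \<xi> f k t = glue (2 ^ k) (\<lambda>i u. c i * f' u) t" .
  qed
  then show ?thesis using that by blast
qed

section \<open>Cyclic shifts; monotonicity and right continuity of distribution functions\<close>

lemma sum_mod_shift:
  fixes g :: "nat \<Rightarrow> 'a::comm_monoid_add"
  shows "(\<Sum>i<P. g ((i + j) mod P)) = (\<Sum>i<P. g i)"
proof (cases "P = 0")
  case False
  have le: "a = b" if "a \<le> b" "b < P" "(a + j) mod P = (b + j) mod P" for a b
  proof -
    have "P dvd (b + j) - (a + j)"
      using that by (subst mod_eq_dvd_iff_nat[symmetric]) auto
    with that show ?thesis
      using dvd_imp_le[of P "b - a"] by fastforce
  qed
  have "inj_on (\<lambda>i. (i + j) mod P) {..<P}"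
  proof (rule inj_onI)
    fix a b assume "a \<in> {..<P}" "b \<in> {..<P}" "(a + j) mod P = (b + j) mod P"
    then show "a = b"
      using le[of a b] le[of b a] by (cases "a \<le> b") auto
  qed
  then have "bij_betw (\<lambda>i. (i + j) mod P) {..<P} {..<P}"
    unfolding bij_betw_def using False by (intro conjI endo_inj_surj) auto
  then show ?thesis
    by (rule sum.reindex_bij_betw)
qed simp

lemma dist_fun_antimono:
  assumes [measurable]: "y \<in> borel_measurable M01" and "s \<le> s'"
  shows "dist_fun y s' \<le> dist_fun y s"
  unfolding dist_fun_def using assms by (intro M01.finite_measure_mono) auto

text \<open>The sets where y exceeds s + 1/(n+1) increase to the set where y exceeds s, so their
  measures converge to \<open>dist_fun y s\<close>.\<close>

lemma dist_fun_right_cont: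
  assumes [measurable]: "y \<in> borel_measurable M01" and "t < dist_fun y s"
  obtains s' where "s < s'" "t < dist_fun y s'"
proof -
  define A where "A n = {u \<in> space M01. y u > s + 1 / real (Suc n)}" for n
  have "incseq A"
  proof (rule incseq_SucI)
    fix n
    have "1 / real (Suc (Suc n)) \<le> 1 / real (Suc n)" by (simp add: frac_le)
    then show "A n \<subseteq> A (Suc n)" unfolding A_def by auto
  qed
  have "(\<Union>n. A n) = {u \<in> space M01. y u > s}"
  proof (intro equalityI subsetI)
    fix u assume u: "u \<in> {u \<in> space M01. y u > s}"
    then obtain n where "1 / real (Suc n) < y u - s"
      using nat_approx_posE[of "y u - s"] by auto
    then have "u \<in> A n" using u unfolding A_def by auto
    then show "u \<in> (\<Union>n. A n)" by blast
  next
    fix u assume "u \<in> (\<Union>n. A n)"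
    then obtain n where "u \<in> A n" by blast
    then show "u \<in> {u \<in> space M01. y u > s}"
      unfolding A_def by (auto intro: less_trans[rotated] simp: add_strict_increasing2)
  qed
  moreover have "(\<lambda>n. measure M01 (A n)) \<longlonglongrightarrow> measure M01 (\<Union>n. A n)"
    using \<open>incseq A\<close> unfolding A_def by (intro M01.finite_Lim_measure_incseq) auto
  ultimately have "(\<lambda>n. measure M01 (A n)) \<longlonglongrightarrow> dist_fun y s"
    by (simp add: dist_fun_def)
  from order_tendstoD(1)[OF this assms(2)] obtain n where "t < measure M01 (A n)"
    by (auto simp: eventually_sequentially)
  then show ?thesis
    by (intro that[of "s + 1 / real (Suc n)"]) (auto simp: dist_fun_def A_def)
qed

subsection \<open>The decreasing rearrangement of a bounded function\<close>

text \<open>Nonnegativity removes the absolute value from \<open>drearr\<close>. The bound B always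
  belongs to the set whose infimum is taken, so that set is nonempty even at t = 0.\<close>

locale bounded_fun =
  fixes y :: "real \<Rightarrow> real" and B :: real
  assumes y [measurable]: "y \<in> borel_measurable M01"
    and nonneg: "\<And>t. 0 \<le> y t" and bound: "\<And>t. y t \<le> B"
begin

lemma drearr_dist_fun: "drearr y t = Inf {s. 0 \<le> s \<and> dist_fun y s \<le> t}"
  using nonneg by (simp add: drearr_def dist_fun_def)

lemma B_nonneg: "0 \<le> B"
  using nonneg[of 0] bound[of 0] by linarith

lemma dist_fun_B: "dist_fun y B = 0"
proof -
  have "{t \<in> space M01. y t > B} = {}"
    using bound by (auto simp: not_less)
  then show ?thesis unfolding dist_fun_def by (simp only: measure_empty)
qed

text \<open>Monotonicity, measurability and equimeasurability of the rearrangement are all read off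
  from this equivalence. The direction from right to left needs right continuity, to turn a bound by
  the infimum into a strict one.\<close>

lemma less_drearr_iff:
  assumes "0 \<le> s" "0 \<le> t"
  shows "s < drearr y t \<longleftrightarrow> t < dist_fun y s"
proof
  have ne: "{s. 0 \<le> s \<and> dist_fun y s \<le> t} \<noteq> {}"
    using B_nonneg dist_fun_B assms by force
  show "t < dist_fun y s" if "s < drearr y t"
  proof (rule ccontr)
    assume "\<not> ?thesis"
    then have "drearr y t \<le> s"
      unfolding drearr_dist_fun using assms by (intro cInf_lower bdd_belowI[of _ 0]) auto
    with that show False by simp
  qed
  assume "t < dist_fun y s"
  then obtain s' where s': "s < s'" "t < dist_fun y s'"
    using dist_fun_right_cont[OF y] by blast
  have "s' \<le> drearr y t"
    unfolding drearr_dist_fun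
  proof (rule cInf_greatest[OF ne])
    fix r assume "r \<in> {s. 0 \<le> s \<and> dist_fun y s \<le> t}"
    then show "s' \<le> r"
      using dist_fun_antimono[OF y, of r s'] s' by force
  qed
  with s' show "s < drearr y t" by simp
qed

lemma drearr_nonneg: "0 \<le> t \<Longrightarrow> 0 \<le> drearr y t"
  unfolding drearr_dist_fun using B_nonneg dist_fun_B by (intro cInf_greatest) force+

lemma drearr_le: "0 \<le> t \<Longrightarrow> drearr y t \<le> B"
  using less_drearr_iff[of B t] B_nonneg dist_fun_B by (force simp: not_less)

lemma drearr_antimono:
  assumes "0 \<le> t" "t \<le> t'"
  shows "drearr y t' \<le> drearr y t"
  using less_drearr_iff[of "drearr y t" t'] less_drearr_iff[of "drearr y t" t] drearr_nonneg[of t] assms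
  by (auto simp: not_less[symmetric])

text \<open>For negative t the infimum in \<open>drearr\<close> runs over the empty set. After the
  cutoff, each level set for s >= 0 is an interval starting at 0, so the function is Borel on the
  whole line.\<close>

definition "rear t = indicator {0..<1} t * drearr y t"

lemma less_rear_iff: "0 \<le> s \<Longrightarrow> s < rear t \<longleftrightarrow> 0 \<le> t \<and> t < 1 \<and> t < dist_fun y s"
  by (auto simp: rear_def indicator_def less_drearr_iff)

lemma rear_nonneg: "0 \<le> rear t"
  by (auto simp: rear_def indicator_def drearr_nonneg)

lemma rear_measurable [measurable]: "rear \<in> borel_measurable borel"
proof (subst borel_measurable_iff_greater, rule allI)
  fix s
  show "{w \<in> space borel. s < rear w} \<in> sets borel"
  proof (cases "0 \<le> s")
    case True
    then have "{w \<in> space borel. s < rear w} = {0..<min 1 (dist_fun y s)}"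
      by (auto simp: less_rear_iff)
    then show ?thesis by simp
  next
    case False
    then have "{w \<in> space borel. s < rear w} = UNIV"
      by (auto intro: less_le_trans[OF _ rear_nonneg])
    then show ?thesis by simp
  qed
qed

lemma equimeasurable_rear: "equimeasurable rear y"
  unfolding equimeasurable_dist_fun
proof
  fix s
  show "dist_fun rear s = dist_fun y s"
  proof (cases "0 \<le> s")
    case True
    have le: "dist_fun y s \<le> 1" "0 \<le> dist_fun y s"
      unfolding dist_fun_def by simp_all
    have "{t \<in> space M01. rear t > s} = {0..<dist_fun y s}"
      using True le by (auto simp: less_rear_iff space_M01)
    then have "dist_fun rear s = measure M01 {0..<dist_fun y s}"
      unfolding dist_fun_def[of rear] by simp
    also have "\<dots> = measure lebesgue {0..<dist_fun y s}"
      unfolding M01_def using le by (intro measure_restrict_space) auto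
    finally show ?thesis using le by simp
  next
    case False
    then have "{t \<in> space M01. rear t > s} = space M01" "{t \<in> space M01. y t > s} = space M01"
      by (auto intro: less_le_trans[OF _ rear_nonneg] less_le_trans[OF _ nonneg])
    then show ?thesis
      unfolding dist_fun_def by simp
  qed
qed

end

text \<open>Equimeasurability fixes the cumulative distribution function, hence the image measure on
  the line, and the integral is the integral of the identity against that measure.\<close>

lemma equimeasurable_integral:
  assumes [measurable]: "x \<in> borel_measurable M01" "y \<in> borel_measurable M01"
    and "equimeasurable x y"
  shows "integral\<^sup>L M01 x = integral\<^sup>L M01 y"
proof -
  have rd: "real_distribution (distr M01 borel z)" if "z \<in> borel_measurable M01" for z
    using that by (intro M01.real_distribution_distr)
  have cdf: "cdf (distr M01 borel z) a = 1 - dist_fun z a" if [measurable]: "z \<in> borel_measurable M01" for z a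
  proof -
    have "cdf (distr M01 borel z) a = measure M01 (z -` {..a} \<inter> space M01)"
      unfolding cdf_def by (subst measure_distr) auto
    also have "z -` {..a} \<inter> space M01 = space M01 - {t \<in> space M01. z t > a}"
      by auto
    also have "measure M01 \<dots> = 1 - dist_fun z a"
      unfolding dist_fun_def by (subst M01.prob_compl) auto
    finally show ?thesis .
  qed
  have eq: "distr M01 borel x = distr M01 borel y"
    using assms by (intro cdf_unique rd ext) (auto simp: cdf equimeasurable_dist_fun)
  have int: "(LINT u|distr M01 borel z. u) = integral\<^sup>L M01 z" if "z \<in> borel_measurable M01" for z :: "real \<Rightarrow> real"
    using that by (rule integral_distr) simp
  show ?thesis
    using int[OF assms(1)] int[OF assms(2)] unfolding eq by (rule trans[OF sym])
qed

subsection \<open>Symmetric spaces\<close>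

locale symm =
  fixes X :: "(real \<Rightarrow> real) set" and N :: "(real \<Rightarrow> real) \<Rightarrow> real"
  assumes symm: "symmetric_space X N"
begin

lemma meas: "x \<in> X \<Longrightarrow> x \<in> borel_measurable M01"
  and add_mem: "x \<in> X \<Longrightarrow> y \<in> X \<Longrightarrow> (\<lambda>t. x t + y t) \<in> X"
  and scale_mem: "x \<in> X \<Longrightarrow> (\<lambda>t. c * x t) \<in> X"
  and N_nonneg: "x \<in> X \<Longrightarrow> 0 \<le> N x"
  and N_eq_0: "x \<in> X \<Longrightarrow> N x = 0 \<longleftrightarrow> (AE t in M01. x t = 0)"
  and N_add: "x \<in> X \<Longrightarrow> y \<in> X \<Longrightarrow> N (\<lambda>t. x t + y t) \<le> N x + N y"
  and N_scale: "x \<in> X \<Longrightarrow> N (\<lambda>t. c * x t) = \<bar>c\<bar> * N x"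
  and N_one: "N (indicator {0..1}) = 1"
proof -
  have "X \<subseteq> borel_measurable M01"
    and "\<forall>x\<in>X. \<forall>y\<in>X. (\<lambda>t. x t + y t) \<in> X"
    and "\<forall>x\<in>X. \<forall>c::real. (\<lambda>t. c * x t) \<in> X"
    and "\<forall>x\<in>X. N x \<ge> 0"
    and "\<forall>x\<in>X. N x = 0 \<longleftrightarrow> (AE t in M01. x t = 0)"
    and "\<forall>x\<in>X. \<forall>y\<in>X. N (\<lambda>t. x t + y t) \<le> N x + N y"
    and "\<forall>x\<in>X. \<forall>c::real. N (\<lambda>t. c * x t) = \<bar>c\<bar> * N x"
    and one: "N (indicator {0..1}) = 1"
    using symm unfolding symmetric_space_def by - (elim conjE, assumption)+
  note rules = this
  show "x \<in> X \<Longrightarrow> x \<in> borel_measurable M01"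
    using rules(1) by (rule subsetD)
  show "x \<in> X \<Longrightarrow> y \<in> X \<Longrightarrow> (\<lambda>t. x t + y t) \<in> X"
    using rules(2)[THEN bspec, THEN bspec] .
  show "x \<in> X \<Longrightarrow> (\<lambda>t. c * x t) \<in> X"
    using rules(3)[THEN bspec, THEN spec] .
  show "x \<in> X \<Longrightarrow> 0 \<le> N x"
    using rules(4)[THEN bspec] .
  show "x \<in> X \<Longrightarrow> N x = 0 \<longleftrightarrow> (AE t in M01. x t = 0)"
    using rules(5)[THEN bspec] .
  show "x \<in> X \<Longrightarrow> y \<in> X \<Longrightarrow> N (\<lambda>t. x t + y t) \<le> N x + N y"
    using rules(6)[THEN bspec, THEN bspec] .
  show "x \<in> X \<Longrightarrow> N (\<lambda>t. c * x t) = \<bar>c\<bar> * N x"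
    using rules(7)[THEN bspec, THEN spec] .
  show "N (indicator {0..1}) = 1"
    by (rule one)
qed

lemma
  assumes "y \<in> X" "x \<in> borel_measurable M01" "AE t in M01. \<bar>x t\<bar> \<le> \<bar>y t\<bar>"
  shows dominated_mem: "x \<in> X" and N_mono: "N x \<le> N y"
proof -
  have "\<forall>x y. y \<in> X \<and> x \<in> borel_measurable M01 \<and> (AE t in M01. \<bar>x t\<bar> \<le> \<bar>y t\<bar>)
      \<longrightarrow> x \<in> X \<and> N x \<le> N y"
    using symm unfolding symmetric_space_def by - (elim conjE, assumption)
  then have "x \<in> X \<and> N x \<le> N y"
    using assms by (metis (no_types))
  then show "x \<in> X" "N x \<le> N y" by auto
qed

lemma
  assumes "y \<in> X" "x \<in> borel_measurable M01" "equimeasurable x y"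
  shows equimeasurable_mem: "x \<in> X" and N_equimeasurable: "N x = N y"
proof -
  have "\<forall>x y. y \<in> X \<and> x \<in> borel_measurable M01 \<and> equimeasurable x y
      \<longrightarrow> x \<in> X \<and> N x = N y"
    using symm unfolding symmetric_space_def by - (elim conjE, assumption)
  then have "x \<in> X \<and> N x = N y"
    using assms by (metis (no_types))
  then show "x \<in> X" "N x = N y" by auto
qed

lemma
  assumes "y \<in> X" "x \<in> borel_measurable M01" "AE t in M01. x t = y t"
  shows cong_mem: "x \<in> X" and N_cong: "N x = N y"
proof -
  have le: "AE t in M01. \<bar>x t\<bar> \<le> \<bar>y t\<bar>" "AE t in M01. \<bar>y t\<bar> \<le> \<bar>x t\<bar>"
    using assms(3) by (auto elim: eventually_mono)
  show "x \<in> X" using dominated_mem[OF assms(1,2) le(1)] .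
  then show "N x = N y"
    using N_mono[OF assms(1,2) le(1)] N_mono[OF _ meas[OF assms(1)] le(2)] by simp
qed

lemma
  assumes "finite A" "A \<noteq> {}" "\<And>a. a \<in> A \<Longrightarrow> u a \<in> X"
  shows sum_mem: "(\<lambda>t. \<Sum>a\<in>A. u a t) \<in> X"
    and N_sum: "N (\<lambda>t. \<Sum>a\<in>A. u a t) \<le> (\<Sum>a\<in>A. N (u a))"
proof -
  have "(\<lambda>t. \<Sum>a\<in>A. u a t) \<in> X \<and> N (\<lambda>t. \<Sum>a\<in>A. u a t) \<le> (\<Sum>a\<in>A. N (u a))"
    using assms
  proof (induction A rule: finite_ne_induct)
    case (insert a A)
    have a: "u a \<in> X" and A: "(\<lambda>t. \<Sum>a\<in>A. u a t) \<in> X" "N (\<lambda>t. \<Sum>a\<in>A. u a t) \<le> (\<Sum>a\<in>A. N (u a))"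
      using insert by auto
    show ?case
      using add_mem[OF a A(1)] N_add[OF a A(1)] A(2) insert.hyps by simp
  qed auto
  then show "(\<lambda>t. \<Sum>a\<in>A. u a t) \<in> X" "N (\<lambda>t. \<Sum>a\<in>A. u a t) \<le> (\<Sum>a\<in>A. N (u a))"
    by auto
qed

text \<open>A cyclic shift of the first P pieces leaves the distribution, hence the norm, unchanged.
  Adding up all P shifts puts the total of the pieces into each of the first P slots, and the
  triangle inequality gives the factor P.\<close>

lemma
  assumes [measurable]: "\<And>i. i < P \<Longrightarrow> h i \<in> borel_measurable borel"
    and P: "0 < P" "P \<le> K"
    and mem: "glue K (\<lambda>i u. if i < P then h i u else 0) \<in> X" (is "?G \<in> X")
  shows block_average_mem: "glue K (\<lambda>i u. if i < P then \<Sum>j<P. h j u else 0) \<in> X"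
    and N_block_average: "N (glue K (\<lambda>i u. if i < P then \<Sum>j<P. h j u else 0)) \<le> real P * N ?G"
proof -
  \<comment> \<open>\<open>H j\<close> is the shift by j places; the remaining K - P slots stay
    zero.\<close>
  define H where "H j i u = (if i < P then h ((i + j) mod P) u else 0)" for j i u
  have Hm: "H j i \<in> borel_measurable borel" for j i
    unfolding H_def[abs_def] using P(1) by (cases "i < P") auto
  have m: "glue K (H j) \<in> borel_measurable M01" for j
    using Hm by (intro borel_measurable_M01I glue_measurable)
  have hm: "(\<lambda>u. if i < P then h i u else 0) \<in> borel_measurable borel" for i
    by (cases "i < P") auto
  have split: "(\<Sum>i<K. F i) = (\<Sum>i<P. F i) + (\<Sum>i\<in>{P..<K}. F i)" for F :: "nat \<Rightarrow> real"
    using P by (metis atLeast0LessThan le0 sum.atLeastLessThan_concat)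
  have "equimeasurable (glue K (H j)) ?G" for j
    unfolding equimeasurable_dist_fun
  proof
    fix s
    have "(\<Sum>i<P. dist_fun (H j i) s) = (\<Sum>i<P. dist_fun (h ((i + j) mod P)) s)"
      by (intro sum.cong) (auto simp: H_def[abs_def])
    also have "\<dots> = (\<Sum>i<P. dist_fun (h i) s)"
      by (rule sum_mod_shift)
    also have "\<dots> = (\<Sum>i<P. dist_fun (\<lambda>u. if i < P then h i u else 0) s)"
      by (intro sum.cong) auto
    finally have "(\<Sum>i<K. dist_fun (H j i) s) = (\<Sum>i<K. dist_fun (\<lambda>u. if i < P then h i u else 0) s)"
      by (simp add: split H_def[abs_def])
    then show "dist_fun (glue K (H j)) s = dist_fun ?G s"
      using P by (subst (1 2) dist_fun_glue) (use Hm hm in auto)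
  qed
  then have Hj: "glue K (H j) \<in> X" "N (glue K (H j)) = N ?G" for j
    using equimeasurable_mem[OF mem m] N_equimeasurable[OF mem m] by auto
  have "(\<Sum>j<P. H j i u) = (if i < P then \<Sum>j<P. h j u else 0)" for i u
    using sum_mod_shift[of "\<lambda>j. h j u" i P] by (simp add: H_def add.commute)
  then have eq: "(\<lambda>t. \<Sum>j<P. glue K (H j) t) = glue K (\<lambda>i u. if i < P then \<Sum>j<P. h j u else 0)"
    unfolding glue_def by (subst sum.swap) (simp add: sum_distrib_left[symmetric])
  have ne: "{..<P} \<noteq> {}" using P by auto
  show "glue K (\<lambda>i u. if i < P then \<Sum>j<P. h j u else 0) \<in> X"
    using sum_mem[OF _ ne, of "\<lambda>j. glue K (H j)"] Hj by (simp add: eq)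
  show "N (glue K (\<lambda>i u. if i < P then \<Sum>j<P. h j u else 0)) \<le> real P * N ?G"
    using N_sum[OF _ ne, of "\<lambda>j. glue K (H j)"] Hj by (simp add: eq)
qed

end

section \<open>Equimeasurable glued functions\<close>

text \<open>This brings pieces from the right end, where E lies, to the front, as
  \<open>block_average_mem\<close> expects.\<close>

lemma equimeasurable_glue_reverse:
  assumes "\<And>i. i < K \<Longrightarrow> H i \<in> borel_measurable borel" and "0 < K"
  shows "equimeasurable (glue K (\<lambda>i. H (K - Suc i))) (glue K H)"
  unfolding equimeasurable_dist_fun
proof
  fix s
  have "(\<Sum>i<K. dist_fun (H (K - Suc i)) s) = (\<Sum>i<K. dist_fun (H i) s)"
    by (rule sum.nat_diff_reindex)
  then show "dist_fun (glue K (\<lambda>i. H (K - Suc i))) s = dist_fun (glue K H) s"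
    using assms by (simp add: dist_fun_glue)
qed

text \<open>P copies of g in M P slots fill the fraction 1/M of the interval, exactly as one copy in
  M slots does, and the latter is the dilated function.\<close>

lemma equimeasurable_glue_dilation:
  assumes [measurable]: "g \<in> borel_measurable borel"
    and "\<And>u. u \<notin> {0..<1} \<Longrightarrow> g u = 0" and "0 < M" "0 < P"
  shows "equimeasurable (glue (M * P) (\<lambda>i u. if i < P then g u else 0)) (\<lambda>s. g (real M * s))"
  unfolding equimeasurable_dist_fun
proof
  fix s
  \<comment> \<open>The right-hand side is free of Q; the cases Q = P and Q = 1 are then
    compared.\<close>
  have D: "dist_fun (glue (M * Q) (\<lambda>i u. if i < Q then g u else 0)) s =
      (dist_fun g s + (real M - 1) * dist_fun (\<lambda>_. 0) s) / real M" if "0 < Q" for Q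
  proof -
    have "Q \<le> M * Q" using \<open>0 < M\<close> by simp
    have m: "(\<lambda>u. if i < Q then g u else 0) \<in> borel_measurable borel" for i
      by (cases "i < Q") auto
    have "dist_fun (\<lambda>u. if i < Q then g u else 0) s =
        (if i < Q then dist_fun g s else dist_fun (\<lambda>_. 0) s)" for i
      by simp
    then have "dist_fun (glue (M * Q) (\<lambda>i u. if i < Q then g u else 0)) s =
        (\<Sum>i<M * Q. if i < Q then dist_fun g s else dist_fun (\<lambda>_. 0) s) / real (M * Q)"
      using m that \<open>0 < M\<close> by (subst dist_fun_glue) auto
    also have "(\<Sum>i<M * Q. if i < Q then dist_fun g s else dist_fun (\<lambda>_. 0) s) =
        (\<Sum>i<Q. if i < Q then dist_fun g s else dist_fun (\<lambda>_. 0) s) +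
        (\<Sum>i\<in>{Q..<M * Q}. if i < Q then dist_fun g s else dist_fun (\<lambda>_. 0) s)"
      using \<open>Q \<le> M * Q\<close> by (metis atLeast0LessThan le0 sum.atLeastLessThan_concat)
    also have "\<dots> = real Q * (dist_fun g s + (real M - 1) * dist_fun (\<lambda>_. 0) s)"
      using \<open>Q \<le> M * Q\<close> by (simp add: of_nat_diff algebra_simps)
    also have "\<dots> / real (M * Q) = (dist_fun g s + (real M - 1) * dist_fun (\<lambda>_. 0) s) / real M"
      using that by simp
    finally show ?thesis .
  qed
  have "glue M (\<lambda>i u. if i < 1 then g u else 0) = (\<lambda>s. g (real M * s))"
  proof
    fix t
    have "glue M (\<lambda>i u. if i < 1 then g u else 0) t =
        (\<Sum>i<M. if i = 0 then indicator {0..<1} (real M * t) * g (real M * t) else 0)"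
      unfolding glue_def by (intro sum.cong) auto
    also have "\<dots> = g (real M * t)"
      using \<open>0 < M\<close> assms(2)[of "real M * t"] by (auto simp: indicator_def)
    finally show "glue M (\<lambda>i u. if i < 1 then g u else 0) t = g (real M * t)" .
  qed
  with D[of 1] D[OF \<open>0 < P\<close>]
  show "dist_fun (glue (M * P) (\<lambda>i u. if i < P then g u else 0)) s = dist_fun (\<lambda>s. g (real M * s)) s"
    by simp
qed

lemma equimeasurable_indicator:
  assumes [measurable]: "A \<in> sets M01" "B \<in> sets M01" and "measure M01 A = measure M01 B"
  shows "equimeasurable (indicator A) (indicator B)"
proof -
  have "measure M01 {t \<in> space M01. (indicator S t :: real) > s} =
      (if s < 0 then 1 else if s < 1 then measure M01 S else 0)" if S: "S \<in> sets M01" for S s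
  proof -
    have "S \<subseteq> space M01" using sets.sets_into_space[OF S] .
    then have "{t \<in> space M01. (indicator S t :: real) > s} =
        (if s < 0 then space M01 else if s < 1 then S else {})"
      by (auto simp: indicator_def)
    then show ?thesis
      by (simp add: M01.prob_space)
  qed
  then show ?thesis
    using assms by (simp add: equimeasurable_def)
qed

section \<open>Embedding of a symmetric space into L_1\<close>

context symm
begin

text \<open>Cut the rearrangement g into K pieces and sum over all cyclic shifts. At each point the
  result is K times a Riemann sum of g, hence at least K times the integral minus B by monotonicity.
  Comparison with a constant function and K tending to infinity give the claim.\<close>

lemma bounded_integral_le:
  assumes one: "indicator {0..1} \<in> X" and y: "y \<in> X"
    and bounds: "\<And>t. 0 \<le> y t" "\<And>t. y t \<le> B"
  shows "integral\<^sup>L M01 y \<le> N y"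
proof -
  interpret b: bounded_fun y B
    using meas[OF y] bounds by unfold_locales auto
  let ?g = "b.rear"
  have gm: "?g \<in> borel_measurable M01"
    by (intro borel_measurable_M01I) measurable
  have gX: "?g \<in> X" "N ?g = N y"
    using equimeasurable_mem[OF y gm b.equimeasurable_rear]
      N_equimeasurable[OF y gm b.equimeasurable_rear] by auto
  have gI: "integral\<^sup>L M01 ?g = integral\<^sup>L M01 y"
    using gm meas[OF y] b.equimeasurable_rear by (rule equimeasurable_integral)
  have g_le: "?g t \<le> B" for t
    using b.drearr_le[of t] b.B_nonneg by (auto simp: b.rear_def indicator_def)
  have g_anti: "?g t' \<le> ?g t" if "0 \<le> t" "t \<le> t'" for t t'
    using b.drearr_antimono[OF that] b.drearr_nonneg[of t] that by (auto simp: b.rear_def indicator_def)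
  have key: "integral\<^sup>L M01 ?g - B / real (Suc m) \<le> N y" for m
  proof -
    define K where "K = Suc m"
    then have "0 < K" by simp
    \<comment> \<open>The i-th piece of g stretched to [0,1), so that gluing the pieces returns g on
      (0,1).\<close>
    define h where "h i u = ?g ((real i + u) / real K)" for i :: nat and u
    have hm [measurable]: "h i \<in> borel_measurable borel" for i
      unfolding h_def[abs_def] by measurable
    have h_bounds: "0 \<le> h i u" "h i u \<le> B" for i u
      unfolding h_def using b.rear_nonneg g_le by auto
    have hI: "integrable M01 (h i)" for i
      using h_bounds by (intro M01.integrable_const_bound[of _ B]) (auto intro: borel_measurable_M01I)
    have hle: "integral\<^sup>L M01 (h i) \<le> c" if "\<And>v. 0 < v \<Longrightarrow> v < 1 \<Longrightarrow> h i v \<le> c" for i c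
    proof -
      have "integral\<^sup>L M01 (h i) \<le> (LINT v|M01. c)"
        using hI that by (intro integral_mono_AE AE_M01I[of "{}"]) auto
      then show ?thesis by (simp add: M01.prob_space)
    qed
    let ?G = "glue K (\<lambda>i u. if i < K then h i u else 0)"
    have Gg: "glue K h' t = ?g t" if t: "0 < t" "t < 1" and h': "\<And>i. i < K \<Longrightarrow> h' i = h i" for h' t
    proof -
      obtain i where i: "i < K" "0 \<le> real K * t - real i" "real K * t - real i < 1"
        by (rule glue_index[of t K]) (use t \<open>0 < K\<close> in auto)
      show ?thesis
        using h'[OF i(1)] \<open>0 < K\<close> by (simp add: glue_eq[OF i] h_def)
    qed
    have Gm: "?G \<in> borel_measurable M01"
      by (intro borel_measurable_M01I glue_measurable) simp
    have ae: "AE t in M01. ?G t = ?g t"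
      by (rule AE_M01I[of "{}"]) (auto intro: Gg)
    have G: "?G \<in> X" "N ?G = N y"
      using cong_mem[OF gX(1) Gm ae] N_cong[OF gX(1) Gm ae] gX(2) by auto
    let ?H = "glue K (\<lambda>i u. if i < K then \<Sum>j<K. h j u else 0)"
    have H: "?H \<in> X" "N ?H \<le> real K * N y"
      using block_average_mem[OF hm \<open>0 < K\<close> order_refl G(1)]
        N_block_average[OF hm \<open>0 < K\<close> order_refl G(1)] G(2) by auto
    have "integral\<^sup>L M01 ?g = integral\<^sup>L M01 (glue K h)"
      using gm by (intro integral_cong_AE AE_M01I[of "{}"])
        (auto intro!: Gg[symmetric] borel_measurable_M01I glue_measurable)
    also have "\<dots> = (\<Sum>i<K. integral\<^sup>L M01 (h i)) / real K"
      using hI \<open>0 < K\<close> by (intro integral_glue) auto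
    finally have sumI: "real K * integral\<^sup>L M01 ?g = (\<Sum>i<K. integral\<^sup>L M01 (h i))"
      using \<open>0 < K\<close> by simp
    \<comment> \<open>Since g decreases, each value of piece j dominates the mean of piece j + 1.
      The mean of piece 0 has no predecessor and is discarded at the cost B.\<close>
    have low: "real K * integral\<^sup>L M01 ?g - B \<le> (\<Sum>j<K. h j u)" if u: "0 \<le> u" "u < 1" for u
    proof -
      have "integral\<^sup>L M01 (h (Suc j)) \<le> h j u" for j
        using u \<open>0 < K\<close> unfolding h_def[of j]
        by (intro hle, unfold h_def, intro g_anti divide_right_mono) auto
      then have "(\<Sum>j<m. integral\<^sup>L M01 (h (Suc j))) \<le> (\<Sum>j<m. h j u)"
        by (intro sum_mono)
      moreover have "integral\<^sup>L M01 (h 0) \<le> B"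
        using h_bounds by (intro hle) auto
      moreover have "0 \<le> h m u" by (rule h_bounds)
      ultimately show ?thesis
        unfolding sumI unfolding K_def by (subst sum.lessThan_Suc_shift) simp
    qed
    \<comment> \<open>The lower bound may be negative; truncation at 0 makes it comparable in
      absolute value.\<close>
    define c where "c = max 0 (real K * integral\<^sup>L M01 ?g - B)"
    have "c \<ge> 0" by (simp add: c_def)
    have "N (\<lambda>t. c * indicator {0..1} t) \<le> N ?H"
    proof (rule N_mono[OF H(1) meas[OF scale_mem[OF one]]])
      show "AE t in M01. \<bar>c * indicator {0..1} t\<bar> \<le> \<bar>?H t\<bar>"
      proof (rule AE_M01I[of "{}"])
        fix t :: real assume t: "0 < t" "t < 1"
        obtain i where i: "i < K" "0 \<le> real K * t - real i" "real K * t - real i < 1"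
          by (rule glue_index[of t K]) (use t \<open>0 < K\<close> in auto)
        have "c \<le> (\<Sum>j<K. h j (real K * t - real i))"
          using low[OF i(2,3)] h_bounds unfolding c_def by (auto intro: sum_nonneg)
        then show "\<bar>c * indicator {0..1} t\<bar> \<le> \<bar>?H t\<bar>"
          using i \<open>c \<ge> 0\<close> t by (simp add: glue_eq[OF i])
      qed simp
    qed
    then have "c \<le> real K * N y"
      using H(2) N_scale[OF one, of c] N_one \<open>c \<ge> 0\<close> by simp
    then have "real K * integral\<^sup>L M01 ?g - B \<le> real K * N y"
      by (simp add: c_def)
    then show ?thesis
      using \<open>0 < K\<close> unfolding K_def[symmetric] by (simp add: field_simps)
  qed
  have "(\<lambda>m. integral\<^sup>L M01 ?g - B / real (Suc m)) \<longlonglongrightarrow> integral\<^sup>L M01 ?g - 0"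
    by (intro tendsto_intros LIMSEQ_Suc[OF lim_const_over_n])
  then have "integral\<^sup>L M01 ?g \<le> N y"
    using key by (intro LIMSEQ_le_const2) auto
  then show ?thesis by (simp add: gI)
qed

text \<open>The truncations of the absolute value at height n are bounded elements of X of norm at
  most N y; monotone convergence carries the bounded case over to y.\<close>

lemma
  assumes one: "indicator {0..1} \<in> X" and y: "y \<in> X"
  shows integrable_mem: "integrable M01 y"
    and integral_abs_le_N: "(LINT t|M01. \<bar>y t\<bar>) \<le> N y"
proof -
  have [measurable]: "y \<in> borel_measurable M01" by (rule meas[OF y])
  define z where "z n t = min \<bar>y t\<bar> (real n)" for n t
  have zm [measurable]: "z n \<in> borel_measurable M01" for n
    unfolding z_def[abs_def] by measurable
  have z: "z n \<in> X" "N (z n) \<le> N y" for n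
    using dominated_mem[OF y zm] N_mono[OF y zm] by (auto simp: z_def)
  have "(\<integral>\<^sup>+ t. ennreal (z n t) \<partial>M01) \<le> ennreal (N y)" for n
  proof -
    have "integrable M01 (z n)"
      by (intro M01.integrable_const_bound[of _ "real n"]) (auto simp: z_def)
    then have "(\<integral>\<^sup>+ t. ennreal (z n t) \<partial>M01) = ennreal (integral\<^sup>L M01 (z n))"
      by (rule nn_integral_eq_integral) (auto simp: z_def)
    also have "integral\<^sup>L M01 (z n) \<le> N (z n)"
      by (intro bounded_integral_le[OF one z(1), of _ "real n"]) (auto simp: z_def)
    finally show ?thesis
      using z(2)[of n] by (meson ennreal_leI order_trans)
  qed
  moreover have "(\<lambda>n. \<integral>\<^sup>+ t. ennreal (z n t) \<partial>M01) \<longlonglongrightarrow> (\<integral>\<^sup>+ t. ennreal \<bar>y t\<bar> \<partial>M01)"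
  proof (rule nn_integral_LIMSEQ)
    show "incseq (\<lambda>n t. ennreal (z n t))"
      by (auto simp: incseq_def le_fun_def z_def intro!: ennreal_leI)
    fix t
    have "\<forall>\<^sub>F n in sequentially. ennreal \<bar>y t\<bar> = ennreal (z n t)"
      using eventually_ge_at_top[of "nat \<lceil>\<bar>y t\<bar>\<rceil>"]
      by eventually_elim (simp add: z_def min_def nat_le_iff ceiling_le_iff)
    then show "(\<lambda>n. ennreal (z n t)) \<longlonglongrightarrow> ennreal \<bar>y t\<bar>"
      using tendsto_const by (rule Lim_transform_eventually[rotated])
  qed auto
  ultimately have nn: "(\<integral>\<^sup>+ t. ennreal \<bar>y t\<bar> \<partial>M01) \<le> ennreal (N y)"
    by (intro LIMSEQ_le_const2) auto
  then have "(\<integral>\<^sup>+ t. ennreal (norm (y t)) \<partial>M01) < \<infinity>"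
    by (simp add: le_less_trans ennreal_less_top)
  then show I: "integrable M01 y"
    by (intro integrableI_bounded) auto
  have "ennreal (LINT t|M01. \<bar>y t\<bar>) \<le> ennreal (N y)"
    using nn I by (subst (asm) nn_integral_eq_integral) auto
  then show "(LINT t|M01. \<bar>y t\<bar>) \<le> N y"
    using N_nonneg[OF y] by simp
qed

end

subsection \<open>Level sums of a decreasing function\<close>

text \<open>Vanishing off (0,1) makes f(r s) with r >= 1 a dilation without any cutoff, and makes f
  decreasing on the whole half-line u > 0.\<close>

locale decreasing_elem = symm +
  fixes f :: "real \<Rightarrow> real"
  assumes f_meas [measurable]: "f \<in> borel_measurable borel"
    and f_supp: "\<And>u. u \<notin> {0<..<1} \<Longrightarrow> f u = 0"
    and f_nonneg: "\<And>u. 0 \<le> f u"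
    and f_anti: "\<And>u v. 0 < u \<Longrightarrow> u \<le> v \<Longrightarrow> v < 1 \<Longrightarrow> f v \<le> f u"
    and f_mem: "f \<in> X"
begin

lemma f_le: "0 < u \<Longrightarrow> u \<le> v \<Longrightarrow> f v \<le> f u"
  using f_anti[of u v] f_supp[of v] f_nonneg[of u] by (cases "v < 1") auto

lemma dilation_mem:
  assumes "1 \<le> r"
  shows "(\<lambda>s. f (r * s)) \<in> X"
proof (rule dominated_mem[OF f_mem])
  show "(\<lambda>s. f (r * s)) \<in> borel_measurable M01"
    by (intro borel_measurable_M01I) measurable
  show "AE s in M01. \<bar>f (r * s)\<bar> \<le> \<bar>f s\<bar>"
    using assms f_nonneg by (intro AE_M01I[of "{}"]) (auto intro!: f_le)
qed

lemma N_dilation_antimono: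
  assumes "1 \<le> r" "r \<le> r'"
  shows "N (\<lambda>s. f (r' * s)) \<le> N (\<lambda>s. f (r * s))"
proof (rule N_mono[OF dilation_mem[OF assms(1)]])
  show "(\<lambda>s. f (r' * s)) \<in> borel_measurable M01"
    by (intro borel_measurable_M01I) measurable
  show "AE s in M01. \<bar>f (r' * s)\<bar> \<le> \<bar>f (r * s)\<bar>"
    using assms f_nonneg by (intro AE_M01I[of "{}"]) (auto intro!: f_le)
qed

text \<open>The definition of a symmetric space fixes the norm of the constant 1 but does not assert its
  membership: \<open>X\<close> may consist of the null functions only.\<close>

lemma one_mem:
  assumes "\<not> (AE t in M01. f t = 0)"
  shows "indicator {0..1} \<in> X"
proof -
  obtain p where p: "0 < p" "p < 1" "f p \<noteq> 0"
    using assms AE_M01I[of "{}" "\<lambda>t. f t = 0"] by auto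
  then have fp: "0 < f p"
    using f_nonneg[of p] by linarith
  obtain m where m: "1 / real (Suc m) < p"
    using nat_approx_posE[OF p(1)] by auto
  define K where "K = Suc m"
  have "0 < K" by (simp add: K_def)
  \<comment> \<open>Since 1/K < p, the function f is at least f p > 0 on (0, 1/K). So the indicator
    of the first slot is dominated by a multiple of f, and summing its K cyclic shifts yields the
    constant 1.\<close>
  let ?h = "\<lambda>i u. if i = 0 then 1 else 0 :: real"
  let ?G = "glue K (\<lambda>i u. if i < K then ?h i u else 0)"
  have "?G \<in> X"
  proof (rule dominated_mem[OF scale_mem[OF f_mem, of "1 / f p"]])
    show "?G \<in> borel_measurable M01"
      by (intro borel_measurable_M01I glue_measurable) simp
    show "AE t in M01. \<bar>?G t\<bar> \<le> \<bar>1 / f p * f t\<bar>"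
    proof (rule AE_M01I[of "{}"])
      fix t :: real assume t: "0 < t" "t < 1"
      obtain i where i: "i < K" "0 \<le> real K * t - real i" "real K * t - real i < 1"
        by (rule glue_index[of t K]) (use t \<open>0 < K\<close> in auto)
      show "\<bar>?G t\<bar> \<le> \<bar>1 / f p * f t\<bar>"
      proof (cases "i = 0")
        case True
        then have "t < 1 / real K"
          using i \<open>0 < K\<close> by (simp add: field_simps)
        then have "f p \<le> f t"
          using m t by (intro f_le) (auto simp: K_def)
        then show ?thesis
          using fp True i(1) by (simp add: glue_eq[OF i] field_simps)
      qed (simp add: glue_eq[OF i])
    qed simp
  qed
  then have H: "glue K (\<lambda>i u. if i < K then \<Sum>j<K. ?h j u else 0) \<in> X"
    using \<open>0 < K\<close> by (intro block_average_mem) auto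
  show ?thesis
  proof (rule dominated_mem[OF H])
    show "indicator {0..1} \<in> borel_measurable M01"
      by (intro borel_measurable_M01I) measurable
    show "AE t in M01. \<bar>indicator {0..1} t :: real\<bar> \<le> \<bar>glue K (\<lambda>i u. if i < K then \<Sum>j<K. ?h j u else 0) t\<bar>"
    proof (rule AE_M01I[of "{}"])
      fix t :: real assume t: "0 < t" "t < 1"
      obtain i where i: "i < K" "0 \<le> real K * t - real i" "real K * t - real i < 1"
        by (rule glue_index[of t K]) (use t \<open>0 < K\<close> in auto)
      show "\<bar>indicator {0..1} t :: real\<bar> \<le> \<bar>glue K (\<lambda>i u. if i < K then \<Sum>j<K. ?h j u else 0) t\<bar>"
        using i(1) \<open>0 < K\<close> by (simp add: glue_eq[OF i] indicator_def)
    qed simp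
  qed
qed

text \<open>Keep only the last P pieces, with absolute values of the coefficients; this does not
  increase the norm. Move them to the front and sum over cyclic shifts. All P slots then carry the
  same multiple of f, so the result is equimeasurable with that multiple of the dilation.\<close>

lemma level_N_lower_bound:
  assumes K: "K = M * P" "0 < M" "0 < P" and L: "glue K (\<lambda>i u. c i * f u) \<in> X"
  shows "(\<Sum>j<P. \<bar>c (K - Suc j)\<bar>) * N (\<lambda>s. f (real M * s)) \<le> real P * N (glue K (\<lambda>i u. c i * f u))"
proof -
  have "0 < K" "P \<le> K" using K by auto
  \<comment> \<open>Numbered from the right: piece 0 carries the coefficient of the rightmost
    interval.\<close>
  define h where "h i u = \<bar>c (K - Suc i)\<bar> * f u" for i :: nat and u
  have hm [measurable]: "h i \<in> borel_measurable borel" for i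
    unfolding h_def[abs_def] by measurable
  define H where "H i u = (if i < P then h i u else 0)" for i :: nat and u
  have Hm: "H i \<in> borel_measurable borel" for i
    unfolding H_def[abs_def] by (cases "i < P") auto
  let ?R = "glue K (\<lambda>i. H (K - Suc i))"
  have Rm: "?R \<in> borel_measurable M01" and Gm: "glue K H \<in> borel_measurable M01"
    using Hm by (auto intro!: borel_measurable_M01I glue_measurable)
  have le: "AE t in M01. \<bar>?R t\<bar> \<le> \<bar>glue K (\<lambda>i u. c i * f u) t\<bar>"
  proof (rule AE_M01I[of "{}"])
    fix t :: real assume "0 < t" "t < 1"
    then show "\<bar>?R t\<bar> \<le> \<bar>glue K (\<lambda>i u. c i * f u) t\<bar>"
      using \<open>0 < K\<close> by (intro glue_cong[where R = "\<lambda>a b. \<bar>a\<bar> \<le> \<bar>b\<bar>"]) (auto simp: H_def h_def abs_mult)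
  qed simp
  have R: "?R \<in> X" "N ?R \<le> N (glue K (\<lambda>i u. c i * f u))"
    using dominated_mem[OF L Rm le] N_mono[OF L Rm le] by auto
  have eq: "equimeasurable (glue K H) ?R"
    using equimeasurable_glue_reverse[of K H] Hm \<open>0 < K\<close> by (simp add: equimeasurable_def)
  have G: "glue K (\<lambda>i u. if i < P then h i u else 0) \<in> X"
      "N (glue K (\<lambda>i u. if i < P then h i u else 0)) = N ?R"
    using equimeasurable_mem[OF R(1) Gm eq] N_equimeasurable[OF R(1) Gm eq]
    by (simp_all add: H_def[abs_def])
  define S where "S = (\<Sum>j<P. \<bar>c (K - Suc j)\<bar>)"
  have hS: "(\<Sum>j<P. h j u) = S * f u" for u
    by (simp add: h_def S_def sum_distrib_right)
  have A: "glue K (\<lambda>i u. if i < P then S * f u else 0) \<in> X"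
      "N (glue K (\<lambda>i u. if i < P then S * f u else 0)) \<le> real P * N ?R"
    using block_average_mem[OF hm \<open>0 < P\<close> \<open>P \<le> K\<close> G(1)] N_block_average[OF hm \<open>0 < P\<close> \<open>P \<le> K\<close> G(1)] G(2)
    unfolding hS by simp_all
  have eqS: "equimeasurable (\<lambda>s. S * f (real M * s)) (glue K (\<lambda>i u. if i < P then S * f u else 0))"
    using equimeasurable_glue_dilation[of "\<lambda>u. S * f u" M P] K f_supp
    by (force simp: equimeasurable_def)
  have mS: "(\<lambda>s. S * f (real M * s)) \<in> borel_measurable M01"
    by (intro borel_measurable_M01I) measurable
  have "N (\<lambda>s. S * f (real M * s)) \<le> real P * N ?R"
    using N_equimeasurable[OF A(1) mS eqS] A(2) by simp
  moreover have "N (\<lambda>s. S * f (real M * s)) = S * N (\<lambda>s. f (real M * s))"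
    using N_scale[OF dilation_mem[of "real M"], of S] \<open>0 < M\<close> by (simp add: S_def sum_nonneg)
  moreover have "real P * N ?R \<le> real P * N (glue K (\<lambda>i u. c i * f u))"
    using R(2) by (intro mult_left_mono) auto
  ultimately show ?thesis
    by (simp add: S_def)
qed

text \<open>Up to a null set, [1 - 1/M, 1] is the union of the last P of the K grid intervals, and
  each contributes its coefficient times the integral of f divided by K.\<close>

lemma level_integral_bound_fine:
  assumes K: "K = M * P" "0 < M" "0 < P" and fI: "integrable M01 f"
  shows "\<bar>LINT t|M01. indicator {1 - 1 / real M..1} t * glue K (\<lambda>i u. c i * f u) t\<bar> \<le>
    (\<Sum>j<P. \<bar>c (K - Suc j)\<bar>) * integral\<^sup>L M01 f / real K"
proof -
  have "0 < K" "P \<le> K" using K by auto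
  let ?F = "integral\<^sup>L M01 f"
  have F: "0 \<le> ?F" using f_nonneg by simp
  define h where "h i u = (if K - Suc i < P then c i else 0) * f u" for i :: nat and u
  have hm [measurable]: "h i \<in> borel_measurable borel" for i
    unfolding h_def[abs_def] by measurable
  have "(LINT t|M01. indicator {1 - 1 / real M..1} t * glue K (\<lambda>i u. c i * f u) t) = integral\<^sup>L M01 (glue K h)"
  proof (rule integral_cong_AE)
    show "AE t in M01. indicator {1 - 1 / real M..1} t * glue K (\<lambda>i u. c i * f u) t = glue K h t"
    proof (rule AE_M01I[of "{}"])
      fix t :: real assume t: "0 < t" "t < 1"
      obtain i where i: "i < K" "0 \<le> real K * t - real i" "real K * t - real i < 1"
        by (rule glue_index[of t K]) (use t \<open>0 < K\<close> in auto)
      have "t \<ge> 1 - 1 / real M \<longleftrightarrow> real K * t \<ge> real K - real P"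
      proof -
        have "t \<ge> 1 - 1 / real M \<longleftrightarrow> real K * t \<ge> real K * (1 - 1 / real M)"
          using \<open>0 < K\<close> by (subst mult_le_cancel_left_pos) auto
        also have "real K * (1 - 1 / real M) = real K - real P"
          using K by (simp add: field_simps)
        finally show ?thesis .
      qed
      also have "\<dots> \<longleftrightarrow> K - Suc i < P"
        using i \<open>P \<le> K\<close> by linarith
      finally show "indicator {1 - 1 / real M..1} t * glue K (\<lambda>i u. c i * f u) t = glue K h t"
        using t by (simp add: glue_eq[OF i] h_def indicator_def)
    qed simp
  qed (auto intro!: borel_measurable_M01I glue_measurable borel_measurable_times borel_measurable_indicator)
  also have "\<dots> = (\<Sum>i<K. integral\<^sup>L M01 (h i)) / real K"
    using fI \<open>0 < K\<close> by (intro integral_glue) (auto simp: h_def[abs_def])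
  also have "\<bar>\<dots>\<bar> \<le> (\<Sum>i<K. (if K - Suc i < P then \<bar>c i\<bar> else 0) * ?F) / real K"
  proof -
    have "\<bar>\<Sum>i<K. integral\<^sup>L M01 (h i)\<bar> \<le> (\<Sum>i<K. \<bar>integral\<^sup>L M01 (h i)\<bar>)"
      by (rule sum_abs)
    also have "\<dots> = (\<Sum>i<K. (if K - Suc i < P then \<bar>c i\<bar> else 0) * ?F)"
      using F by (intro sum.cong) (auto simp: h_def[abs_def] abs_mult)
    finally show ?thesis
      by (simp add: divide_right_mono)
  qed
  \<comment> \<open>The summand is displayed as a function of K - Suc i so that reversal of the
    summation order applies.\<close>
  also have "(\<Sum>i<K. (if K - Suc i < P then \<bar>c i\<bar> else 0) * ?F) =
      (\<Sum>i<K. (\<lambda>j. (if j < P then \<bar>c (K - Suc j)\<bar> else 0) * ?F) (K - Suc i))"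
    by (intro sum.cong) auto
  also have "\<dots> = (\<Sum>j<K. (if j < P then \<bar>c (K - Suc j)\<bar> else 0) * ?F)"
    by (rule sum.nat_diff_reindex)
  also have "\<dots> = (\<Sum>j<P. \<bar>c (K - Suc j)\<bar> * ?F)"
    using \<open>P \<le> K\<close> by (intro sum.mono_neutral_cong_right) auto
  finally show ?thesis
    by (simp add: sum_distrib_right)
qed

text \<open>Here [1 - 1/M, 1] is the last J-th part of the last grid interval, so only the
  coefficient of that interval and the tail of f matter.\<close>

lemma level_integral_bound_coarse:
  assumes M: "M = K * J" "0 < K" "0 < J" and fI: "integrable M01 f"
  shows "\<bar>LINT t|M01. indicator {1 - 1 / real M..1} t * glue K (\<lambda>i u. c i * f u) t\<bar> \<le>
    \<bar>c (K - 1)\<bar> * integral\<^sup>L M01 f / real M"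
proof -
  have "0 < M" using M by simp
  let ?F = "integral\<^sup>L M01 f"
  let ?d = "c (K - 1)"
  \<comment> \<open>The last J-th part of f stretched to [0,1). The stretched argument is at least u
    and f decreases, so e lies below f; this bounds the mean over the end segment by the total
    mean.\<close>
  define e where "e u = f ((real J - 1 + u) / real J)" for u
  have em [measurable]: "e \<in> borel_measurable borel"
    unfolding e_def[abs_def] by measurable
  have e_le: "0 \<le> e u" "0 < u \<Longrightarrow> u < 1 \<Longrightarrow> e u \<le> f u" for u
  proof -
    show "0 \<le> e u" by (simp add: e_def f_nonneg)
    assume u: "0 < u" "u < 1"
    have "0 \<le> (real J - 1) * (1 - u)"
      using u \<open>0 < J\<close> by (intro mult_nonneg_nonneg) auto
    then have "u \<le> (real J - 1 + u) / real J"
      using \<open>0 < J\<close> by (simp add: field_simps)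
    then show "e u \<le> f u"
      unfolding e_def using u by (intro f_le) auto
  qed
  have ae: "AE u in M01. e u \<le> f u"
    by (rule AE_M01I[of "{}"]) (auto intro: e_le)
  have eI: "integrable M01 e"
    using ae by (intro Bochner_Integration.integrable_bound[OF fI])
      (auto intro: borel_measurable_M01I simp: e_le f_nonneg)
  have e_int: "integral\<^sup>L M01 e \<le> ?F"
    using eI fI ae by (rule integral_mono_AE)
  define h where "h i u = (if i = M - 1 then ?d else 0) * e u" for i :: nat and u
  have hm [measurable]: "h i \<in> borel_measurable borel" for i
    unfolding h_def[abs_def] by measurable
  have "(LINT t|M01. indicator {1 - 1 / real M..1} t * glue K (\<lambda>i u. c i * f u) t) = integral\<^sup>L M01 (glue M h)"
  proof (rule integral_cong_AE)
    show "AE t in M01. indicator {1 - 1 / real M..1} t * glue K (\<lambda>i u. c i * f u) t = glue M h t"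
    proof (rule AE_M01I[of "{}"])
      fix t :: real assume t: "0 < t" "t < 1"
      obtain i where i: "i < M" "0 \<le> real M * t - real i" "real M * t - real i < 1"
        by (rule glue_index[of t M]) (use t \<open>0 < M\<close> in auto)
      have iff: "t \<ge> 1 - 1 / real M \<longleftrightarrow> i = M - 1"
      proof -
        have "t \<ge> 1 - 1 / real M \<longleftrightarrow> real M * t \<ge> real M - 1"
          using \<open>0 < M\<close> by (simp add: field_simps)
        also have "\<dots> \<longleftrightarrow> i = M - 1"
          using i by linarith
        finally show ?thesis .
      qed
      show "indicator {1 - 1 / real M..1} t * glue K (\<lambda>i u. c i * f u) t = glue M h t"
      proof (cases "i = M - 1")
        case True
        have Kt: "real K * t - real (K - 1) = (real J - 1 + (real M * t - real (M - 1))) / real J"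
          using M \<open>0 < M\<close> by (simp add: of_nat_diff field_simps)
        have b: "0 \<le> real K * t - real (K - 1)" "real K * t - real (K - 1) < 1"
        proof -
          show "0 \<le> real K * t - real (K - 1)"
            unfolding Kt using i True \<open>0 < J\<close> by (intro divide_nonneg_nonneg) auto
          have "real K * t < real K * 1"
            using t \<open>0 < K\<close> by (intro mult_strict_left_mono) auto
          then show "real K * t - real (K - 1) < 1"
            using \<open>0 < K\<close> by (simp add: of_nat_diff)
        qed
        have "glue K (\<lambda>i u. c i * f u) t = ?d * f (real K * t - real (K - 1))"
          using \<open>0 < K\<close> b by (intro glue_eq) auto
        moreover have "f (real K * t - real (K - 1)) = e (real M * t - real i)"
          unfolding Kt e_def True ..
        moreover have "t \<in> {1 - 1 / real M..1}"
          using iff True t by simp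
        ultimately show ?thesis
          using True by (simp add: glue_eq[OF i] h_def)
      next
        case False
        then have "t \<notin> {1 - 1 / real M..1}" using iff by simp
        then show ?thesis
          using False by (simp add: glue_eq[OF i] h_def)
      qed
    qed simp
  qed (auto intro!: borel_measurable_M01I glue_measurable borel_measurable_times borel_measurable_indicator)
  also have "\<dots> = (\<Sum>i<M. integral\<^sup>L M01 (h i)) / real M"
    using eI \<open>0 < M\<close> by (intro integral_glue) (auto simp: h_def[abs_def])
  also have "(\<Sum>i<M. integral\<^sup>L M01 (h i)) = (\<Sum>i<M. if i = M - 1 then ?d * integral\<^sup>L M01 e else 0)"
    by (intro sum.cong) (auto simp: h_def[abs_def])
  also have "\<dots> = ?d * integral\<^sup>L M01 e"
    using \<open>0 < M\<close> by simp
  finally have "\<bar>LINT t|M01. indicator {1 - 1 / real M..1} t * glue K (\<lambda>i u. c i * f u) t\<bar> =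
      \<bar>?d\<bar> * integral\<^sup>L M01 e / real M"
    using e_le(1) by (simp add: abs_mult)
  also have "\<dots> \<le> \<bar>?d\<bar> * ?F / real M"
    using e_int by (intro divide_right_mono mult_left_mono) auto
  finally show ?thesis .
qed

text \<open>The coefficients enter the integral bound and the norm bound through the same quantity,
  so they drop out when the two are combined.\<close>

lemma level_bound:
  assumes fI: "integrable M01 f" and L: "glue (2 ^ k) (\<lambda>i u. c i * f u) \<in> X"
  shows "N (\<lambda>s. f (2 ^ n * s)) *
      \<bar>LINT t|M01. indicator {1 - 1 / 2 ^ n..1} t * glue (2 ^ k) (\<lambda>i u. c i * f u) t\<bar> \<le>
    integral\<^sup>L M01 f / 2 ^ n * N (glue (2 ^ k) (\<lambda>i u. c i * f u))"
proof -
  let ?F = "integral\<^sup>L M01 f" and ?L = "glue (2 ^ k) (\<lambda>i u. c i * f u)"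
  let ?D = "N (\<lambda>s. f (2 ^ n * s))"
  have F: "0 \<le> ?F" using f_nonneg by simp
  have D: "0 \<le> ?D" by (intro N_nonneg dilation_mem) simp
  show ?thesis
  proof (cases "n \<le> k")
    case True
    define K M P :: nat where "K = 2 ^ k" and "M = 2 ^ n" and "P = 2 ^ (k - n)"
    have K: "K = M * P" "0 < M" "0 < P"
      using True by (auto simp: K_def M_def P_def power_add[symmetric])
    let ?S = "\<Sum>j<P. \<bar>c (K - Suc j)\<bar>"
    have "?D * \<bar>LINT t|M01. indicator {1 - 1 / real M..1} t * glue K (\<lambda>i u. c i * f u) t\<bar> \<le>
        ?D * (?S * ?F / real K)"
      using D by (intro mult_left_mono level_integral_bound_fine[OF K fI])
    also have "\<dots> = ?F / real K * (?S * N (\<lambda>s. f (real M * s)))"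
      by (simp add: M_def)
    also have "\<dots> \<le> ?F / real K * (real P * N (glue K (\<lambda>i u. c i * f u)))"
      using F L by (intro mult_left_mono level_N_lower_bound[OF K]) (auto simp: K_def)
    also have "\<dots> = ?F / real M * N (glue K (\<lambda>i u. c i * f u))"
      using K by simp
    finally show ?thesis
      by (simp add: K_def M_def)
  next
    case False
    define K M J :: nat where "K = 2 ^ k" and "M = 2 ^ n" and "J = 2 ^ (n - k)"
    have M: "M = K * J" "0 < K" "0 < J"
      using False by (auto simp: K_def M_def J_def power_add[symmetric])
    \<comment> \<open>The norm bound is taken with a single piece, P = 1, and dilation factor K. As
      k < n, the stronger compression by 2^n has smaller norm.\<close>
    have "\<bar>c (K - 1)\<bar> * N (\<lambda>s. f (real K * s)) \<le> N (glue K (\<lambda>i u. c i * f u))"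
      using level_N_lower_bound[of K K 1 c] M L by (simp add: K_def)
    moreover have "?D \<le> N (\<lambda>s. f (real K * s))"
      using False by (intro N_dilation_antimono) (auto simp: K_def)
    ultimately have le: "\<bar>c (K - 1)\<bar> * ?D \<le> N (glue K (\<lambda>i u. c i * f u))"
      by (meson abs_ge_zero mult_left_mono order_trans)
    have "?D * \<bar>LINT t|M01. indicator {1 - 1 / real M..1} t * glue K (\<lambda>i u. c i * f u) t\<bar> \<le>
        ?D * (\<bar>c (K - 1)\<bar> * ?F / real M)"
      using D by (intro mult_left_mono level_integral_bound_coarse[OF M fI])
    also have "\<dots> = ?F / real M * (\<bar>c (K - 1)\<bar> * ?D)"
      by simp
    also have "\<dots> \<le> ?F / real M * N (glue K (\<lambda>i u. c i * f u))"
      using F le by (intro mult_left_mono) auto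
    finally show ?thesis
      by (simp add: K_def M_def)
  qed
qed

end

section \<open>Indicators of intervals and the fundamental function\<close>

lemma measure_M01_interval: "0 \<le> a \<Longrightarrow> a \<le> b \<Longrightarrow> b \<le> 1 \<Longrightarrow> measure M01 {a..b} = b - a"
  unfolding M01_def by (subst measure_restrict_space) auto

lemma sets_M01_interval: "0 \<le> a \<Longrightarrow> b \<le> 1 \<Longrightarrow> {a..b} \<in> sets M01"
  unfolding M01_def by (auto simp: sets_restrict_space_iff)

context symm
begin

lemma indicator_interval_mem:
  assumes one: "indicator {0..1} \<in> X" and "0 \<le> a" "b \<le> 1"
  shows "indicator {a..b} \<in> X"
proof (rule dominated_mem[OF one])
  show "indicator {a..b} \<in> borel_measurable M01"
    by (intro borel_measurable_M01I) measurable
  show "AE t in M01. \<bar>indicator {a..b} t :: real\<bar> \<le> \<bar>indicator {0..1} t\<bar>"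
    by (rule AE_M01I[of "{}"]) (auto simp: indicator_def)
qed

lemma N_indicator_interval:
  assumes one: "indicator {0..1} \<in> X" and ab: "0 \<le> a" "a \<le> b" "b \<le> 1"
  shows "N (indicator {a..b}) = fundamental N (b - a)"
  unfolding fundamental_def
proof (rule N_equimeasurable)
  show "indicator {0..b - a} \<in> X"
    using one ab by (intro indicator_interval_mem[OF one]) auto
  show "indicator {a..b} \<in> borel_measurable M01"
    by (intro borel_measurable_M01I) measurable
  show "equimeasurable (indicator {a..b}) (indicator {0..b - a})"
    using ab by (intro equimeasurable_indicator sets_M01_interval) (auto simp: measure_M01_interval)
qed

lemma fundamental_mono:
  assumes one: "indicator {0..1} \<in> X" and "s \<le> t" "t \<le> 1"
  shows "fundamental N s \<le> fundamental N t"
  unfolding fundamental_def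
proof (rule N_mono)
  show "indicator {0..t} \<in> X"
    using assms by (intro indicator_interval_mem[OF one]) auto
  show "indicator {0..s} \<in> borel_measurable M01"
    by (intro borel_measurable_M01I) measurable
  show "AE u in M01. \<bar>indicator {0..s} u :: real\<bar> \<le> \<bar>indicator {0..t} u\<bar>"
    using assms by (intro AE_M01I[of "{}"]) (auto simp: indicator_def)
qed

text \<open>Split [0,t'] at t: the right part has length at most t, and its norm depends only on its
  length.\<close>

lemma fundamental_doubling:
  assumes one: "indicator {0..1} \<in> X" and t: "0 < t" "t \<le> t'" "t' \<le> 2 * t" "t' \<le> 1"
  shows "fundamental N t' \<le> 2 * fundamental N t"
proof -
  have m: "indicator {0..t} \<in> X" "indicator {t..t'} \<in> X"
    using t by (auto intro!: indicator_interval_mem[OF one])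
  have "fundamental N t' \<le> N (\<lambda>u. indicator {0..t} u + indicator {t..t'} u)"
    unfolding fundamental_def
  proof (rule N_mono[OF add_mem[OF m]])
    show "indicator {0..t'} \<in> borel_measurable M01"
      by (intro borel_measurable_M01I) measurable
    show "AE u in M01. \<bar>indicator {0..t'} u :: real\<bar> \<le> \<bar>indicator {0..t} u + indicator {t..t'} u\<bar>"
      by (rule AE_M01I[of "{}"]) (auto simp: indicator_def)
  qed
  also have "\<dots> \<le> N (indicator {0..t}) + N (indicator {t..t'})"
    by (rule N_add[OF m])
  also have "N (indicator {t..t'}) = fundamental N (t' - t)"
    using t by (intro N_indicator_interval[OF one]) auto
  also have "\<dots> \<le> fundamental N t"
    using t by (intro fundamental_mono[OF one]) auto
  finally show ?thesis
    by (simp add: fundamental_def)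
qed

end

section \<open>The estimate for dyadic dilations\<close>

text \<open>\<open>g\<close> is the given function and \<open>f\<close> its Borel version. The
  representing property also involves values of \<open>g\<close> off (0,1), so it stays with
  \<open>g\<close>, and the individual levels are rewritten through \<open>f\<close> almost
  everywhere.\<close>

lemma (in decreasing_elem) dyadic_bound:
  assumes one: "indicator {0..1} \<in> X"
    and agree: "\<And>u. 0 < u \<Longrightarrow> u < 1 \<Longrightarrow> g u = f u"
    and rep: "abs_representing X N g C"
  shows "N (\<lambda>s. f (2 ^ n * s)) \<le> C * integral\<^sup>L M01 f * fundamental N (1 / 2 ^ n)"
proof -
  let ?F = "integral\<^sup>L M01 f" and ?D = "N (\<lambda>s. f (2 ^ n * s))"
  let ?E = "{1 - 1 / 2 ^ n..1::real}"
  let ?x = "indicator ?E :: real \<Rightarrow> real"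
  have E: "0 \<le> 1 - 1 / (2::real) ^ n" by simp
  have fI: "integrable M01 f"
    by (rule integrable_mem[OF one f_mem])
  have F: "0 \<le> ?F" using f_nonneg by simp
  have D: "0 \<le> ?D" by (intro N_nonneg dilation_mem) simp
  have xX: "?x \<in> X"
    using E by (intro indicator_interval_mem[OF one]) auto
  have xm: "?x \<in> borel_measurable M01"
    by (rule meas[OF xX])
  obtain \<xi> where L: "\<And>k. level_sum \<xi> g k \<in> X"
    and lim: "(\<lambda>m. N (\<lambda>t. ?x t - (\<Sum>k<m. level_sum \<xi> g k t))) \<longlonglongrightarrow> 0"
    and summ: "summable (\<lambda>k. N (level_sum \<xi> g k))"
    and le: "(\<Sum>k. N (level_sum \<xi> g k)) \<le> C * N ?x"
    using rep xX unfolding abs_representing_def by blast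
  have level: "?D * \<bar>LINT t|M01. ?x t * level_sum \<xi> g k t\<bar> \<le> ?F / 2 ^ n * N (level_sum \<xi> g k)" for k
  proof -
    obtain c where c: "AE t in M01. level_sum \<xi> g k t = glue (2 ^ k) (\<lambda>i u. c i * f u) t"
      by (rule level_sum_glue_AE[of g f]) (use agree in auto)
    let ?L = "glue (2 ^ k) (\<lambda>i u. c i * f u)"
    have Lm: "?L \<in> borel_measurable M01"
      by (intro borel_measurable_M01I glue_measurable) measurable
    have ae: "AE t in M01. ?L t = level_sum \<xi> g k t"
      using c by eventually_elim simp
    have LX: "?L \<in> X" "N ?L = N (level_sum \<xi> g k)"
      using cong_mem[OF L Lm ae] N_cong[OF L Lm ae] by auto
    have "(LINT t|M01. ?x t * level_sum \<xi> g k t) = (LINT t|M01. ?x t * ?L t)"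
      using c by (intro integral_cong_AE borel_measurable_times xm Lm meas[OF L]) auto
    then show ?thesis
      using level_bound[OF fI LX(1), of n] LX(2) by simp
  qed
  \<comment> \<open>Integrate the m-th partial sum identity over E, whose measure is 2^-n. The L_1
    embedding controls the remainder; multiplication by \<open>?D\<close> makes \<open>level\<close>
    applicable to each term.\<close>
  have bound: "?D / 2 ^ n \<le> ?D * N (\<lambda>t. ?x t - (\<Sum>k<m. level_sum \<xi> g k t)) + ?F / 2 ^ n * (C * N ?x)" for m
  proof -
    define r where "r m t = ?x t - (\<Sum>k<m. level_sum \<xi> g k t)" for m t
    have rX: "r m \<in> X" for m
    proof (induction m)
      case 0
      have "r 0 = ?x" by (simp add: r_def fun_eq_iff)
      then show ?case using xX by simp
    next
      case (Suc m)
      have "(\<lambda>t. r m t + (-1) * level_sum \<xi> g m t) \<in> X"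
        by (intro add_mem scale_mem Suc L)
      moreover have "(\<lambda>t. r m t + (-1) * level_sum \<xi> g m t) = r (Suc m)"
        by (simp add: r_def fun_eq_iff)
      ultimately show ?case by simp
    qed
    have xI: "integrable M01 (\<lambda>t. ?x t * y t)" if "y \<in> X" for y
    proof (rule Bochner_Integration.integrable_bound[OF integrable_mem[OF one that]])
      show "(\<lambda>t. ?x t * y t) \<in> borel_measurable M01"
        by (intro borel_measurable_times xm meas[OF that])
    qed (simp add: indicator_def)
    have "(LINT t|M01. ?x t * ?x t) = (LINT t|M01. ?x t)"
      by (intro Bochner_Integration.integral_cong) (auto simp: indicator_def)
    also have "\<dots> = measure M01 ?E"
      using E sets_M01_interval[of "1 - 1 / 2 ^ n" 1] by (subst Bochner_Integration.integral_indicator) (auto simp: space_M01 Int_absorb1)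
    also have "\<dots> = 1 / 2 ^ n"
      using E by (subst measure_M01_interval) auto
    finally have "1 / 2 ^ n = (LINT t|M01. ?x t * ?x t)" by simp
    also have "\<dots> = (LINT t|M01. ?x t * r m t + (\<Sum>k<m. ?x t * level_sum \<xi> g k t))"
      unfolding r_def sum_distrib_left[symmetric] by (simp only: right_diff_distrib diff_add_cancel)
    also have "\<dots> = (LINT t|M01. ?x t * r m t) + (LINT t|M01. (\<Sum>k<m. ?x t * level_sum \<xi> g k t))"
      by (intro Bochner_Integration.integral_add Bochner_Integration.integrable_sum xI rX L)
    also have "(LINT t|M01. (\<Sum>k<m. ?x t * level_sum \<xi> g k t)) = (\<Sum>k<m. LINT t|M01. ?x t * level_sum \<xi> g k t)"
      by (intro Bochner_Integration.integral_sum xI L)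
    also have "(LINT t|M01. ?x t * r m t) + \<dots> \<le> N (r m) + (\<Sum>k<m. \<bar>LINT t|M01. ?x t * level_sum \<xi> g k t\<bar>)"
    proof (intro add_mono sum_mono abs_ge_self)
      have "(LINT t|M01. ?x t * r m t) \<le> (LINT t|M01. \<bar>r m t\<bar>)"
        using integrable_mem[OF one rX] by (intro integral_mono xI rX) (auto simp: indicator_def)
      then show "(LINT t|M01. ?x t * r m t) \<le> N (r m)"
        using integral_abs_le_N[OF one rX] by (rule order_trans)
    qed
    finally have "?D * (1 / 2 ^ n) \<le> ?D * (N (r m) + (\<Sum>k<m. \<bar>LINT t|M01. ?x t * level_sum \<xi> g k t\<bar>))"
      using D by (rule mult_left_mono)
    also have "\<dots> = ?D * N (r m) + (\<Sum>k<m. ?D * \<bar>LINT t|M01. ?x t * level_sum \<xi> g k t\<bar>)"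
      by (simp add: algebra_simps sum_distrib_left)
    also have "\<dots> \<le> ?D * N (r m) + (\<Sum>k<m. ?F / 2 ^ n * N (level_sum \<xi> g k))"
      using level by (intro add_left_mono sum_mono)
    also have "(\<Sum>k<m. ?F / 2 ^ n * N (level_sum \<xi> g k)) = ?F / 2 ^ n * (\<Sum>k<m. N (level_sum \<xi> g k))"
      by (simp add: sum_distrib_left)
    also have "(\<Sum>k<m. N (level_sum \<xi> g k)) \<le> C * N ?x"
      using sum_le_suminf[OF summ, of "{..<m}"] N_nonneg[OF L] le by (auto intro: order_trans)
    finally show ?thesis
      using F by (simp add: r_def[abs_def] mult_left_mono divide_right_mono)
  qed
  have "(\<lambda>m. ?D * N (\<lambda>t. ?x t - (\<Sum>k<m. level_sum \<xi> g k t)) + ?F / 2 ^ n * (C * N ?x))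
      \<longlonglongrightarrow> ?D * 0 + ?F / 2 ^ n * (C * N ?x)"
    by (intro tendsto_intros lim)
  then have "?D / 2 ^ n \<le> ?F / 2 ^ n * (C * N ?x)"
    using bound by (intro LIMSEQ_le_const) auto
  then have "?D \<le> C * ?F * N ?x"
    by (simp add: field_simps)
  moreover have "N ?x = fundamental N (1 / 2 ^ n)"
    using E N_indicator_interval[OF one E, of 1] by simp
  ultimately show ?thesis by simp
qed

section \<open>From dyadic to arbitrary t\<close>

text \<open>The sets where the absolute value of x exceeds n decrease to the empty set, so for t > 0
  the infimum is over a nonempty set even if x is unbounded. At t = 0 that set can be empty.\<close>

lemma
  assumes [measurable]: "x \<in> borel_measurable M01" and t: "0 < t"
  shows drearr_pos_nonneg: "0 \<le> drearr x t"
    and drearr_pos_antimono: "t \<le> t' \<Longrightarrow> drearr x t' \<le> drearr x t"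
proof -
  define A where "A n = {u \<in> space M01. real n < \<bar>x u\<bar>}" for n
  have "(\<lambda>n. measure M01 (A n)) \<longlonglongrightarrow> measure M01 (\<Inter>n. A n)"
    by (intro M01.finite_Lim_measure_decseq) (auto simp: A_def decseq_def)
  moreover have "(\<Inter>n. A n) = {}"
  proof (rule equals0I)
    fix u assume u: "u \<in> (\<Inter>n. A n)"
    obtain n where "\<bar>x u\<bar> < real n" using reals_Archimedean2 by blast
    moreover have "u \<in> A n" using u by blast
    ultimately show False by (simp add: A_def)
  qed
  ultimately have "(\<lambda>n. measure M01 (A n)) \<longlonglongrightarrow> 0" by simp
  from order_tendstoD(2)[OF this t] obtain n where "measure M01 (A n) < t"
    by (auto simp: eventually_sequentially)
  then have ne: "{s. s \<ge> 0 \<and> measure M01 {u \<in> space M01. \<bar>x u\<bar> > s} \<le> t} \<noteq> {}"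
    unfolding A_def by (auto intro!: exI[of _ "real n"])
  then show "0 \<le> drearr x t"
    unfolding drearr_def by (rule cInf_greatest) auto
  show "drearr x t' \<le> drearr x t" if "t \<le> t'"
    unfolding drearr_def using ne that by (intro cInf_superset_mono bdd_belowI[of _ 0]) auto
qed

theorem theorem3:
  fixes X :: "(real \<Rightarrow> real) set" and N :: "(real \<Rightarrow> real) \<Rightarrow> real"
    and f :: "real \<Rightarrow> real" and C :: real
  assumes "symmetric_space X N" and "separable_symm X N"
    and "f \<in> X" and "\<forall>t\<in>{0..<1}. f t = drearr f t"
    and "abs_representing X N f C"
  shows "\<forall>t. 0 < t \<and> t \<le> 1 \<longrightarrow>
           N (dil t f) \<le> 2 * C * \<bar>LINT s:{0..1}|lborel. f s\<bar> * fundamental N t"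
proof -
  interpret symm X N by unfold_locales (rule assms(1))
  note fm = meas[OF assms(3)]
  have eq: "f t = drearr f t" if "0 < t" "t < 1" for t
    using assms(4) that by simp
  \<comment> \<open>The function f is known to be nonnegative and decreasing only on (0,1); cutting
    it to this interval gives a function that is Borel, because it is monotone there, and equal to f
    almost everywhere on [0,1].\<close>
  define f0 where "f0 t = indicator {0<..<1} t * f t" for t
  have anti: "f v \<le> f u" if "0 < u" "u \<le> v" "v < 1" for u v
    using drearr_pos_antimono[OF fm, of u v] eq[of u] eq[of v] that by simp
  have nonneg: "0 \<le> f u" if "0 < u" "u < 1" for u
    using drearr_pos_nonneg[OF fm, of u] eq[of u] that by simp
  have f0m: "f0 \<in> borel_measurable borel"
  proof -
    have "mono_on {0<..<1} (\<lambda>t. - f t)"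
      using anti by (auto intro!: mono_onI)
    then have "(\<lambda>t. - f t) \<in> borel_measurable (restrict_space borel {0<..<1})"
      by (rule borel_measurable_mono_on_fnc)
    then have "(\<lambda>t. indicator {0<..<1} t *\<^sub>R - f t) \<in> borel_measurable borel"
      by (subst (asm) borel_measurable_restrict_space_iff) auto
    then have "(\<lambda>t. - (indicator {0<..<1} t *\<^sub>R - f t)) \<in> borel_measurable borel"
      by (rule borel_measurable_uminus)
    also have "(\<lambda>t. - (indicator {0<..<1} t *\<^sub>R - f t)) = f0"
      by (simp add: f0_def fun_eq_iff)
    finally show ?thesis .
  qed
  interpret decreasing_elem X N f0
  proof
    show "f0 \<in> X"
      using assms(3) borel_measurable_M01I[OF f0m]
      by (rule cong_mem) (rule AE_M01I[of "{}"], auto simp: f0_def)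
  qed (use f0m nonneg anti in \<open>auto simp: f0_def indicator_def\<close>)
  let ?F = "integral\<^sup>L M01 f0"
  have F: "(LINT s:{0..1}|lborel. f s) = ?F"
  proof -
    \<comment> \<open>The integral is over \<open>lborel\<close>, so Borel measurability is
      required: the integrand differs from \<open>f0\<close> only at the points 0 and 1.\<close>
    have "(\<lambda>s. indicator {0..1} s *\<^sub>R f s) = (\<lambda>s. f0 s + f 0 * indicator {0} s + f 1 * indicator {1} s)"
      by (auto simp: f0_def indicator_def fun_eq_iff)
    also have "\<dots> \<in> borel_measurable borel"
      using f0m by measurable
    finally have m: "(\<lambda>s. indicator {0..1} s *\<^sub>R f s) \<in> borel_measurable borel" .
    have "(LINT s:{0..1}|lborel. f s) = (LINT u|lborel. indicator {0..<1} u * f0 u)"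
      unfolding set_lebesgue_integral_def
    proof (rule integral_cong_AE)
      show "AE s in lborel. indicator {0..1} s *\<^sub>R f s = indicator {0..<1} s * f0 s"
        using AE_lborel_singleton[of "0::real"] AE_lborel_singleton[of "1::real"]
        by eventually_elim (auto simp: f0_def indicator_def)
    qed (use m f0m in auto)
    then show ?thesis
      by (simp add: integral_M01_borel[OF f0m])
  qed
  have F0: "0 \<le> ?F" using f_nonneg by simp
  show ?thesis
  proof (intro allI impI)
    fix t :: real assume t: "0 < t \<and> t \<le> 1"
    have dil: "dil t f = (\<lambda>s. f0 (1 / t * s))"
      using t by (auto simp: dil_def f0_def indicator_def fun_eq_iff zero_less_divide_iff)
    show "N (dil t f) \<le> 2 * C * \<bar>LINT s:{0..1}|lborel. f s\<bar> * fundamental N t"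
    proof (cases "AE s in M01. f0 s = 0")
      case True
      then have "N f0 = 0" using N_eq_0[OF f_mem] by simp
      then have "N (dil t f) \<le> 0"
        using N_dilation_antimono[of 1 "1 / t"] t by (simp add: dil)
      moreover have "?F = 0"
        using True by (rule integral_eq_zero_AE)
      ultimately show ?thesis by (simp add: F)
    next
      case False
      have one: "indicator {0..1} \<in> X" by (rule one_mem[OF False])
      \<comment> \<open>Representing the constant 1, which has norm 1, bounds C below by a sum of
        norms.\<close>
      have "C \<ge> 0"
      proof -
        obtain \<xi> where "\<And>k. level_sum \<xi> f k \<in> X" "summable (\<lambda>k. N (level_sum \<xi> f k))"
          and le: "(\<Sum>k. N (level_sum \<xi> f k)) \<le> C * N (indicator {0..1})"
          using assms(5) one unfolding abs_representing_def by blast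
        then have "0 \<le> (\<Sum>k. N (level_sum \<xi> f k))"
          using N_nonneg by (intro suminf_nonneg) auto
        with le show ?thesis by (simp add: N_one)
      qed
      \<comment> \<open>The least such m is positive because t <= 1; its predecessor n satisfies t
        <= 2^-n < 2 t.\<close>
      have "\<exists>m. (1 / 2) ^ m < t"
        using t by (intro real_arch_pow_inv) auto
      then have m: "(1 / 2) ^ (LEAST m. (1 / 2) ^ m < t) < t"
        by (rule LeastI_ex)
      then obtain n where n: "(LEAST m. (1 / 2) ^ m < t) = Suc n"
        using t by (cases "LEAST m. (1 / 2) ^ m < t") auto
      then have ge: "t \<le> (1 / 2) ^ n"
        using not_less_Least[of n "\<lambda>m. (1 / 2) ^ m < t"] by simp
      have t': "t \<le> 1 / 2 ^ n" "1 / 2 ^ n \<le> 2 * t"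
        using ge m unfolding n by (simp_all add: power_one_over)
      have "N (dil t f) \<le> N (\<lambda>s. f0 (2 ^ n * s))"
        unfolding dil using t t' by (intro N_dilation_antimono) (auto simp: field_simps)
      also have "\<dots> \<le> C * ?F * fundamental N (1 / 2 ^ n)"
        using one assms(5) by (intro dyadic_bound[where g = f]) (auto simp: f0_def)
      also have "\<dots> \<le> C * ?F * (2 * fundamental N t)"
        using \<open>C \<ge> 0\<close> F0 t t' one by (intro mult_left_mono fundamental_doubling) auto
      finally show ?thesis
        using F0 by (simp add: F)
    qed
  qed
qed

end
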